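(* If $A$ is a complete Heyting algebra with a well-founded basis $K$, then every slice $\mathrm{Sh}(A)/I$ of $\mathrm{Sh}(A)$ is a model of guarded recursive terms.
   Context: Basis and well-foundedness: every $a\in A$ is the join of $\{k\in K\mid k\le a\}$ and $K$ has no infinite strictly descending sequence. $\mathrm{Sh}(A)$: presheaves $X$ on $A$ with $(X(\bigvee B)\to X(b))_{b\in B}$ a limit cone for all $B\subseteq A$. $p(a)=\bigvee\{k\in K\mid k<a\}$; $\blacktriangleright X=\mathbf{a}(X\circ p)$ ($\mathbf{a}$ = associated sheaf functor); $\mathrm{next}_X=\mathbf{a}(\mathrm{next}^{pre}_X)$ with $\mathrm{next}^{pre}_a(x)=x|_{p(a)}$. On the slice over $I$, $\blacktriangleright_I(p_Y:Y\to I)$ is the pullback of $\blacktriangleright p_Y$ along $\mathrm{next}_I:I\to\blacktriangleright I$, and $\mathrm{next}$ on the slice is the map $Y\to\blacktriangleright_I Y$ induced by $p_Y$ and $\mathrm{next}_Y$. A model of guarded recursive terms is a category with finite products, an endofunctor $\blacktriangleright$ preserving finite limits and a natural transformation $\mathrm{next}:\mathrm{id}\to\blacktriangleright$ such that for every $f:\blacktriangleright X\to X$ there is a unique $h:1\to X$ with $f\circ\mathrm{next}\circ h=h$. *)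

theory Defs
  imports "HOL-Library.FuncSet"
begin

section \<open>Categories\<close>

record ('o, 'm) cat =
  Ob :: "'o set"
  Ar :: "'m set"
  Src :: "'m \<Rightarrow> 'o"
  Tgt :: "'m \<Rightarrow> 'o"
  Ide :: "'o \<Rightarrow> 'm"
  Cmp :: "'m \<Rightarrow> 'm \<Rightarrow> 'm"  \<comment> \<open>\<open>Cmp C g f\<close> is \<open>g \<circ> f\<close>\<close>

definition hom :: "('o, 'm) cat \<Rightarrow> 'o \<Rightarrow> 'o \<Rightarrow> 'm set" where
  "hom C X Y = {f \<in> Ar C. Src C f = X \<and> Tgt C f = Y}"

locale category =
  fixes C :: "('o, 'm) cat"
  assumes src_in_Ob: "f \<in> Ar C \<Longrightarrow> Src C f \<in> Ob C"
    and tgt_in_Ob: "f \<in> Ar C \<Longrightarrow> Tgt C f \<in> Ob C"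
    and ide_in_hom: "X \<in> Ob C \<Longrightarrow> Ide C X \<in> hom C X X"
    and cmp_in_hom: "f \<in> hom C X Y \<Longrightarrow> g \<in> hom C Y Z \<Longrightarrow> Cmp C g f \<in> hom C X Z"
    and cmp_ide_left: "f \<in> hom C X Y \<Longrightarrow> Cmp C (Ide C Y) f = f"
    and cmp_ide_right: "f \<in> hom C X Y \<Longrightarrow> Cmp C f (Ide C X) = f"
    and cmp_assoc: "f \<in> hom C W X \<Longrightarrow> g \<in> hom C X Y \<Longrightarrow> h \<in> hom C Y Z \<Longrightarrow>
      Cmp C h (Cmp C g f) = Cmp C (Cmp C h g) f"

record ('o, 'm, 'p, 'n) fctr =
  on_Ob :: "'o \<Rightarrow> 'p"
  on_Ar :: "'m \<Rightarrow> 'n"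

definition is_functor ::
  "('o, 'm) cat \<Rightarrow> ('p, 'n) cat \<Rightarrow> ('o, 'm, 'p, 'n) fctr \<Rightarrow> bool" where
  "is_functor C D F \<longleftrightarrow>
     category C \<and> category D \<and>
     (\<forall>X\<in>Ob C. on_Ob F X \<in> Ob D) \<and>
     (\<forall>X Y. \<forall>f\<in>hom C X Y. on_Ar F f \<in> hom D (on_Ob F X) (on_Ob F Y)) \<and>
     (\<forall>X\<in>Ob C. on_Ar F (Ide C X) = Ide D (on_Ob F X)) \<and>
     (\<forall>X Y Z. \<forall>f\<in>hom C X Y. \<forall>g\<in>hom C Y Z.
        on_Ar F (Cmp C g f) = Cmp D (on_Ar F g) (on_Ar F f))"

definition id_fctr :: "('o, 'm, 'o, 'm) fctr" where
  "id_fctr = \<lparr>on_Ob = (\<lambda>X. X), on_Ar = (\<lambda>f. f)\<rparr>"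

definition comp_fctr ::
  "('p, 'n, 'q, 'k) fctr \<Rightarrow> ('o, 'm, 'p, 'n) fctr \<Rightarrow> ('o, 'm, 'q, 'k) fctr" where
  "comp_fctr G F = \<lparr>on_Ob = (\<lambda>X. on_Ob G (on_Ob F X)), on_Ar = (\<lambda>f. on_Ar G (on_Ar F f))\<rparr>"

definition is_nat_trans ::
  "('o, 'm) cat \<Rightarrow> ('p, 'n) cat \<Rightarrow> ('o, 'm, 'p, 'n) fctr \<Rightarrow> ('o, 'm, 'p, 'n) fctr \<Rightarrow>
    ('o \<Rightarrow> 'n) \<Rightarrow> bool" where
  "is_nat_trans C D F G \<tau> \<longleftrightarrow>
     is_functor C D F \<and> is_functor C D G \<and>
     (\<forall>X\<in>Ob C. \<tau> X \<in> hom D (on_Ob F X) (on_Ob G X)) \<and>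
     (\<forall>X Y. \<forall>f\<in>hom C X Y. Cmp D (\<tau> Y) (on_Ar F f) = Cmp D (on_Ar G f) (\<tau> X))"

definition is_cone ::
  "('i, 'd) cat \<Rightarrow> ('o, 'm) cat \<Rightarrow> ('i, 'd, 'o, 'm) fctr \<Rightarrow> 'o \<Rightarrow> ('i \<Rightarrow> 'm) \<Rightarrow> bool" where
  "is_cone J C D L \<pi> \<longleftrightarrow>
     L \<in> Ob C \<and>
     (\<forall>i\<in>Ob J. \<pi> i \<in> hom C L (on_Ob D i)) \<and>
     (\<forall>i j. \<forall>u\<in>hom J i j. Cmp C (on_Ar D u) (\<pi> i) = \<pi> j)"

definition is_limit_cone ::
  "('i, 'd) cat \<Rightarrow> ('o, 'm) cat \<Rightarrow> ('i, 'd, 'o, 'm) fctr \<Rightarrow> 'o \<Rightarrow> ('i \<Rightarrow> 'm) \<Rightarrow> bool" where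
  "is_limit_cone J C D L \<pi> \<longleftrightarrow>
     is_cone J C D L \<pi> \<and>
     (\<forall>M \<rho>. is_cone J C D M \<rho> \<longrightarrow>
        (\<exists>!h. h \<in> hom C M L \<and> (\<forall>i\<in>Ob J. Cmp C (\<pi> i) h = \<rho> i)))"

text \<open>Every finite category is isomorphic to one whose objects and arrows are natural numbers,
  so quantifying over those covers all finite diagram shapes.\<close>

definition preserves_finite_limits ::
  "('o, 'm) cat \<Rightarrow> ('p, 'n) cat \<Rightarrow> ('o, 'm, 'p, 'n) fctr \<Rightarrow> bool" where
  "preserves_finite_limits C D F \<longleftrightarrow>
     (\<forall>(J :: (nat, nat) cat) E L \<pi>.
        category J \<longrightarrow> finite (Ob J) \<longrightarrow> finite (Ar J) \<longrightarrow> is_functor J C E \<longrightarrow>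
        is_limit_cone J C E L \<pi> \<longrightarrow>
        is_limit_cone J D (comp_fctr F E) (on_Ob F L) (\<lambda>i. on_Ar F (\<pi> i)))"

definition is_product :: "('o, 'm) cat \<Rightarrow> nat \<Rightarrow> (nat \<Rightarrow> 'o) \<Rightarrow> 'o \<Rightarrow> (nat \<Rightarrow> 'm) \<Rightarrow> bool" where
  "is_product C n X P \<pi> \<longleftrightarrow>
     P \<in> Ob C \<and> (\<forall>i<n. \<pi> i \<in> hom C P (X i)) \<and>
     (\<forall>Q\<in>Ob C. \<forall>\<rho>. (\<forall>i<n. \<rho> i \<in> hom C Q (X i)) \<longrightarrow>
        (\<exists>!h. h \<in> hom C Q P \<and> (\<forall>i<n. Cmp C (\<pi> i) h = \<rho> i)))"

definition has_finite_products :: "('o, 'm) cat \<Rightarrow> bool" where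
  "has_finite_products C \<longleftrightarrow>
     (\<forall>n X. (\<forall>i<n. X i \<in> Ob C) \<longrightarrow> (\<exists>P \<pi>. is_product C n X P \<pi>))"

definition is_terminal :: "('o, 'm) cat \<Rightarrow> 'o \<Rightarrow> bool" where
  "is_terminal C T \<longleftrightarrow> T \<in> Ob C \<and> (\<forall>X\<in>Ob C. \<exists>!f. f \<in> hom C X T)"

text \<open>\<open>p\<close> and \<open>q\<close> are the projections of a pullback of \<open>f\<close> and \<open>g\<close>, so that \<open>f \<circ> p = g \<circ> q\<close>.\<close>

definition is_pullback :: "('o, 'm) cat \<Rightarrow> 'm \<Rightarrow> 'm \<Rightarrow> 'm \<Rightarrow> 'm \<Rightarrow> bool" where
  "is_pullback C f g p q \<longleftrightarrow>
     f \<in> Ar C \<and> g \<in> Ar C \<and> Tgt C f = Tgt C g \<and>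
     p \<in> hom C (Src C p) (Src C f) \<and> q \<in> hom C (Src C p) (Src C g) \<and>
     Cmp C f p = Cmp C g q \<and>
     (\<forall>W. \<forall>u\<in>hom C W (Src C f). \<forall>v\<in>hom C W (Src C g). Cmp C f u = Cmp C g v \<longrightarrow>
        (\<exists>!h. h \<in> hom C W (Src C p) \<and> Cmp C p h = u \<and> Cmp C q h = v))"


section \<open>Models of guarded recursive terms\<close>

definition guarded_model ::
  "('o, 'm) cat \<Rightarrow> ('o, 'm, 'o, 'm) fctr \<Rightarrow> ('o \<Rightarrow> 'm) \<Rightarrow> bool" where
  "guarded_model C L \<nu> \<longleftrightarrow>
     category C \<and> has_finite_products C \<and>
     is_functor C C L \<and> preserves_finite_limits C C L \<and>
     is_nat_trans C C id_fctr L \<nu> \<and>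
     (\<forall>T. is_terminal C T \<longrightarrow>
        (\<forall>X\<in>Ob C. \<forall>f\<in>hom C (on_Ob L X) X.
           \<exists>!h. h \<in> hom C T X \<and> Cmp C f (Cmp C (\<nu> X) h) = h))"


section \<open>Slices\<close>

text \<open>Arrows that carry their source and target, used both for slices and for presheaves.\<close>

datatype ('o, 'f) arrow = Arrow (source: 'o) (target: 'o) (underlying: 'f)

definition slice :: "('o, 'm) cat \<Rightarrow> 'o \<Rightarrow> ('m, ('m, 'm) arrow) cat" where
  "slice C I = \<lparr>
     Ob = {p \<in> Ar C. Tgt C p = I},
     Ar = {Arrow p q u | p q u. p \<in> Ar C \<and> Tgt C p = I \<and> q \<in> Ar C \<and> Tgt C q = I \<and>
             u \<in> hom C (Src C p) (Src C q) \<and> Cmp C q u = p},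
     Src = source,
     Tgt = target,
     Ide = (\<lambda>p. Arrow p p (Ide C (Src C p))),
     Cmp = (\<lambda>g f. Arrow (source f) (target g) (Cmp C (underlying g) (underlying f)))\<rparr>"

text \<open>A choice of pullback of \<open>L p\<close> along \<open>\<nu> I\<close>: the first component, the projection to \<open>I\<close>, is
  the pulled-back object of the slice over \<open>I\<close>; the second one maps to \<open>L Y\<close> for \<open>p : Y \<rightarrow> I\<close>.\<close>

definition slice_pullback ::
  "('o, 'm) cat \<Rightarrow> ('o, 'm, 'o, 'm) fctr \<Rightarrow> ('o \<Rightarrow> 'm) \<Rightarrow> 'o \<Rightarrow> 'm \<Rightarrow> 'm \<times> 'm" where
  "slice_pullback C L \<nu> I p = (SOME (r, s). is_pullback C (\<nu> I) (on_Ar L p) r s)"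

definition slice_later ::
  "('o, 'm) cat \<Rightarrow> ('o, 'm, 'o, 'm) fctr \<Rightarrow> ('o \<Rightarrow> 'm) \<Rightarrow> 'o \<Rightarrow>
    ('m, ('m, 'm) arrow, 'm, ('m, 'm) arrow) fctr" where
  "slice_later C L \<nu> I = \<lparr>
     on_Ob = (\<lambda>p. fst (slice_pullback C L \<nu> I p)),
     on_Ar = (\<lambda>f.
       let (r, s) = slice_pullback C L \<nu> I (source f);
           (r', s') = slice_pullback C L \<nu> I (target f)
       in Arrow r r' (THE w. w \<in> hom C (Src C r) (Src C r') \<and>
            Cmp C r' w = r \<and> Cmp C s' w = Cmp C (on_Ar L (underlying f)) s))\<rparr>"

definition slice_next ::
  "('o, 'm) cat \<Rightarrow> ('o, 'm, 'o, 'm) fctr \<Rightarrow> ('o \<Rightarrow> 'm) \<Rightarrow> 'o \<Rightarrow> 'm \<Rightarrow> ('m, 'm) arrow" where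
  "slice_next C L \<nu> I p =
     (let (r, s) = slice_pullback C L \<nu> I p
      in Arrow p r (THE w. w \<in> hom C (Src C p) (Src C r) \<and>
           Cmp C r w = p \<and> Cmp C s w = \<nu> (Src C p)))"


section \<open>Complete Heyting algebras and well-founded bases\<close>

text \<open>The library class \<open>complete_distrib_lattice\<close> demands complete distributivity, which a
  complete Heyting algebra need not satisfy.\<close>

class complete_heyting_algebra = complete_lattice +
  fixes heyting_imp :: "'a \<Rightarrow> 'a \<Rightarrow> 'a"
  assumes le_heyting_imp_iff: "a \<le> heyting_imp b c \<longleftrightarrow> inf a b \<le> c"

definition well_founded_basis :: "'a :: complete_heyting_algebra set \<Rightarrow> bool" where
  "well_founded_basis K \<longleftrightarrow>
     (\<forall>a. a = Sup {k \<in> K. k \<le> a}) \<and>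
     \<not> (\<exists>s :: nat \<Rightarrow> 'a. \<forall>n. s n \<in> K \<and> s (Suc n) < s n)"

definition pred_join :: "'a :: complete_heyting_algebra set \<Rightarrow> 'a \<Rightarrow> 'a" where
  "pred_join K a = Sup {k \<in> K. k < a}"


section \<open>Presheaves and sheaves\<close>

text \<open>The sets of sections are subsets of a type \<open>'u\<close>, which plays the role of a universe of small
  sets. \<open>res X a b\<close> is the restriction map from \<open>sec X a\<close> to \<open>sec X b\<close>; only its values for
  \<open>b \<le> a\<close> on elements of \<open>sec X a\<close> matter.\<close>

record ('a, 'u) presheaf =
  sec :: "'a \<Rightarrow> 'u set"
  res :: "'a \<Rightarrow> 'a \<Rightarrow> 'u \<Rightarrow> 'u"

definition is_presheaf :: "('a :: order, 'u) presheaf \<Rightarrow> bool" where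
  "is_presheaf X \<longleftrightarrow>
     (\<forall>a b. b \<le> a \<longrightarrow> res X a b \<in> sec X a \<rightarrow> sec X b) \<and>
     (\<forall>a. \<forall>x\<in>sec X a. res X a a x = x) \<and>
     (\<forall>a b c. c \<le> b \<longrightarrow> b \<le> a \<longrightarrow> (\<forall>x\<in>sec X a. res X b c (res X a b x) = res X a c x))"

text \<open>The limit-cone condition on \<open>(X (\<Squnion>B) \<rightarrow> X b)\<^bsub>b\<in>B\<^esub>\<close>, spelled out in sets: the limit is the
  set of families that agree on the overlaps \<open>b \<sqinter> c\<close>, and \<open>X (\<Squnion>B)\<close> is in bijection with it.\<close>

definition is_sheaf :: "('a :: complete_heyting_algebra, 'u) presheaf \<Rightarrow> bool" where
  "is_sheaf X \<longleftrightarrow>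
     is_presheaf X \<and>
     (\<forall>(B :: 'a set) x.
        (\<forall>b\<in>B. x b \<in> sec X b) \<longrightarrow>
        (\<forall>b\<in>B. \<forall>c\<in>B. res X b (inf b c) (x b) = res X c (inf b c) (x c)) \<longrightarrow>
        (\<exists>!y. y \<in> sec X (Sup B) \<and> (\<forall>b\<in>B. res X (Sup B) b y = x b)))"

type_synonym ('a, 'u) psh_arrow = "(('a, 'u) presheaf, 'a \<Rightarrow> 'u \<Rightarrow> 'u) arrow"

text \<open>Components of arrows are extensional functions, so that arrows are equal iff they are equal as
  natural transformations.\<close>

definition presheaf_arrows :: "('a :: order, 'u) psh_arrow set" where
  "presheaf_arrows =
     {Arrow X Y f | X Y f. is_presheaf X \<and> is_presheaf Y \<and>
        (\<forall>a. f a \<in> sec X a \<rightarrow>\<^sub>E sec Y a) \<and>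
        (\<forall>a b. b \<le> a \<longrightarrow> (\<forall>x\<in>sec X a. res Y a b (f a x) = f b (res X a b x)))}"

definition PSh :: "(('a :: order, 'u) presheaf, ('a, 'u) psh_arrow) cat" where
  "PSh = \<lparr>
     Ob = {X. is_presheaf X},
     Ar = presheaf_arrows,
     Src = source,
     Tgt = target,
     Ide = (\<lambda>X. Arrow X X (\<lambda>a. \<lambda>x\<in>sec X a. x)),
     Cmp = (\<lambda>g f. Arrow (source f) (target g)
              (\<lambda>a. compose (sec (source f) a) (underlying g a) (underlying f a)))\<rparr>"

definition Sh :: "(('a :: complete_heyting_algebra, 'u) presheaf, ('a, 'u) psh_arrow) cat" where
  "Sh = PSh \<lparr>
     Ob := {X. is_sheaf X},
     Ar := {f \<in> presheaf_arrows. is_sheaf (source f) \<and> is_sheaf (target f)}\<rparr>"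


section \<open>The associated sheaf functor\<close>

text \<open>The left adjoint of the inclusion of \<open>Sh\<close> into \<open>PSh\<close>, given by a choice of universal
  arrows \<open>\<eta> : P \<rightarrow> F\<close> from presheaves \<open>P\<close> to sheaves \<open>F\<close>.\<close>

definition is_sheafification ::
  "('a :: complete_heyting_algebra, 'u) presheaf \<Rightarrow> ('a, 'u) psh_arrow \<Rightarrow> bool" where
  "is_sheafification P \<eta> \<longleftrightarrow>
     \<eta> \<in> hom PSh P (target \<eta>) \<and> is_sheaf (target \<eta>) \<and>
     (\<forall>G. is_sheaf G \<longrightarrow> (\<forall>g\<in>hom PSh P G. \<exists>!h. h \<in> hom Sh (target \<eta>) G \<and> Cmp PSh h \<eta> = g))"

definition sheafify_unit ::
  "('a :: complete_heyting_algebra, 'u) presheaf \<Rightarrow> ('a, 'u) psh_arrow" where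
  "sheafify_unit P = (SOME \<eta>. is_sheafification P \<eta>)"

definition sheafify ::
  "(('a :: complete_heyting_algebra, 'u) presheaf, ('a, 'u) psh_arrow,
    ('a, 'u) presheaf, ('a, 'u) psh_arrow) fctr" where
  "sheafify = \<lparr>
     on_Ob = (\<lambda>P. target (sheafify_unit P)),
     on_Ar = (\<lambda>f. THE g.
       g \<in> hom Sh (target (sheafify_unit (source f))) (target (sheafify_unit (target f))) \<and>
       Cmp PSh g (sheafify_unit (source f)) = Cmp PSh (sheafify_unit (target f)) f)\<rparr>"


section \<open>The later endofunctor on sheaves\<close>

definition precomp_pred ::
  "'a :: complete_heyting_algebra set \<Rightarrow>
    (('a, 'u) presheaf, ('a, 'u) psh_arrow, ('a, 'u) presheaf, ('a, 'u) psh_arrow) fctr" where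
  "precomp_pred K =
     (let Xp = (\<lambda>X. \<lparr>sec = (\<lambda>a. sec X (pred_join K a)),
                     res = (\<lambda>a b. res X (pred_join K a) (pred_join K b))\<rparr>)
      in \<lparr>on_Ob = Xp,
          on_Ar = (\<lambda>f. Arrow (Xp (source f)) (Xp (target f))
                         (\<lambda>a. underlying f (pred_join K a)))\<rparr>)"

definition later ::
  "'a :: complete_heyting_algebra set \<Rightarrow>
    (('a, 'u) presheaf, ('a, 'u) psh_arrow, ('a, 'u) presheaf, ('a, 'u) psh_arrow) fctr" where
  "later K = comp_fctr sheafify (precomp_pred K)"

definition next_pre ::
  "'a :: complete_heyting_algebra set \<Rightarrow> ('a, 'u) presheaf \<Rightarrow> ('a, 'u) psh_arrow" where
  "next_pre K X =
     Arrow X (on_Ob (precomp_pred K) X) (\<lambda>a. \<lambda>x\<in>sec X a. res X a (pred_join K a) x)"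

text \<open>Composing with \<open>sheafify_unit X\<close>, an isomorphism when \<open>X\<close> is a sheaf, turns the sheafified
  map into one with source \<open>X\<close> instead of \<open>sheafify X\<close>.\<close>

definition next_sh ::
  "'a :: complete_heyting_algebra set \<Rightarrow> ('a, 'u) presheaf \<Rightarrow> ('a, 'u) psh_arrow" where
  "next_sh K X = Cmp PSh (on_Ar sheafify (next_pre K X)) (sheafify_unit X)"


section \<open>Universes of sections\<close>

text \<open>To have associated sheaves inside \<open>'u\<close>, it suffices that \<open>'u\<close> is infinite and that the
  functions from \<open>'a\<close> to \<open>'u\<close> can be encoded in \<open>'u\<close>. Every type \<open>'x\<close> embeds in such a \<open>'u\<close>.\<close>

lemma section_universe_exists:
  "infinite (UNIV :: ('a list \<Rightarrow> 'x set) set)"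
  "\<exists>d :: ('a \<Rightarrow> 'a list \<Rightarrow> 'x set) \<Rightarrow> ('a list \<Rightarrow> 'x set). inj d"
  "\<exists>e :: 'x \<Rightarrow> 'a list \<Rightarrow> 'x set. inj e"
proof -
  have "inj (\<lambda>l. (\<lambda>m. if m = l then UNIV else {}) :: 'a list \<Rightarrow> 'x set)"
    by (rule injI) (metis UNIV_not_empty)
  then show "infinite (UNIV :: ('a list \<Rightarrow> 'x set) set)"
    using infinite_UNIV_listI finite_imageD finite_subset subset_UNIV by metis
  show "\<exists>d :: ('a \<Rightarrow> 'a list \<Rightarrow> 'x set) \<Rightarrow> ('a list \<Rightarrow> 'x set). inj d"
  proof (intro exI injI ext)
    fix g h :: "'a \<Rightarrow> 'a list \<Rightarrow> 'x set" and a l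
    assume "(\<lambda>m. g (hd m) (tl m)) = (\<lambda>m. h (hd m) (tl m))"
    then show "g a l = h a l"
      using fun_cong[of "\<lambda>m. g (hd m) (tl m)" "\<lambda>m. h (hd m) (tl m)" "a # l"] by simp
  qed
  show "\<exists>e :: 'x \<Rightarrow> 'a list \<Rightarrow> 'x set. inj e"
    by (rule exI[of _ "\<lambda>x _. {x}"]) (auto intro!: injI dest: fun_cong)
qed

end

theory Submission
  imports Defs
begin

text \<open>Discard from \<open>K\<close> the elements \<open>k\<close> with \<open>p(k) = k\<close>. By well-foundedness what is left is still a basis,
  and each of its elements \<open>k\<close> is completely join-prime: the part of \<open>k\<close> covered by any \<open>B\<close> not containing
  an upper bound of \<open>k\<close> lies below \<open>p(k) < k\<close>. So \<open>Sh(A)\<close> amounts to presheaves on a well-founded poset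
  of primes, where \<open>\<triangleright>X(k) = X(p(k))\<close>.

  Over a prime \<open>k\<close> a section of \<open>\<triangleright>\<^sub>I Y\<close> is therefore a pair of \<open>i \<in> I(k)\<close> and \<open>y \<in> Y(p(k))\<close>
  over \<open>i|\<^bsub>p(k)\<^esub>\<close>. Limits in a slice can be computed sectionwise over primes, so \<open>\<triangleright>\<^sub>I\<close> preserves them.
  For \<open>f : \<triangleright>\<^sub>I Y \<rightarrow> Y\<close>, well-founded induction on \<open>k\<close> shows that over each \<open>i \<in> I(k)\<close> there is
  exactly one \<open>y \<in> Y(k)\<close> with \<open>f(next(y)) = y\<close>: its restriction to \<open>p(k)\<close> is determined by the induction
  hypothesis, and \<open>next(y)\<close> depends only on \<open>i\<close> and this restriction. Uniqueness makes these \<open>y\<close>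
  the values of a map.\<close>

section \<open>Slices of a category with pullbacks\<close>

text \<open>Both \<open>sheafify_unit\<close> and \<open>slice_pullback\<close> are choices of which
  only a universal property is known. Two devices make them computable. Maps out of representable
  sheaves turn pullbacks and limit cones into statements about sections. For sheafification, one
  explicit associated sheaf is built, and its bijectivity over primes is carried to every other
  choice by comparison maps.

  The obstacle is that p(k) need not be prime, so an induction hypothesis about primes says nothing
  directly about Y(p(k)). However, the primes below p(k) are exactly those strictly below k, and
  sections over them glue whenever they are the unique solutions of a condition that can be checked
  on primes. For the same reason the limit property of a cone is used over arbitrary elements, while
  it has to be verified over primes only.\<close>

lemma homE:
  assumes "f \<in> hom C X Y"
  shows "f \<in> Ar C" "Src C f = X" "Tgt C f = Y"
  using assms by (simp_all add: hom_def)

lemma slice_simps [simp]: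
  "Src (slice C I) = source"
  "Tgt (slice C I) = target"
  "Ide (slice C I) p = Arrow p p (Ide C (Src C p))"
  "Cmp (slice C I) g f = Arrow (source f) (target g) (Cmp C (underlying g) (underlying f))"
  by (simp_all add: slice_def)

lemma slice_Ob_iff: "p \<in> Ob (slice C I) \<longleftrightarrow> p \<in> hom C (Src C p) I"
  by (auto simp: slice_def hom_def)

lemma slice_hom_iff:
  "f \<in> hom (slice C I) p q \<longleftrightarrow>
     source f = p \<and> target f = q \<and> p \<in> Ob (slice C I) \<and> q \<in> Ob (slice C I) \<and>
     underlying f \<in> hom C (Src C p) (Src C q) \<and> Cmp C q (underlying f) = p"
  by (cases f) (auto simp: slice_def hom_def)

lemma slice_homD:
  assumes "f \<in> hom (slice C I) p q"
  shows "source f = p" "target f = q" "p \<in> hom C (Src C p) I" "q \<in> hom C (Src C q) I"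
    "underlying f \<in> hom C (Src C p) (Src C q)" "Cmp C q (underlying f) = p"
  using assms by (simp_all add: slice_hom_iff slice_Ob_iff)

lemma slice_arrow_eqI:
  "f \<in> hom (slice C I) p q \<Longrightarrow> g \<in> hom (slice C I) p q \<Longrightarrow> underlying f = underlying g \<Longrightarrow> f = g"
  by (rule arrow.expand) (simp add: slice_hom_iff)

lemma is_pullback_ex1:
  assumes "is_pullback C f g p q" "u \<in> hom C W (Src C f)" "v \<in> hom C W (Src C g)" "Cmp C f u = Cmp C g v"
  shows "\<exists>!h. h \<in> hom C W (Src C p) \<and> Cmp C p h = u \<and> Cmp C q h = v"
  using assms unfolding is_pullback_def by blast

lemma is_pullbackD:
  assumes "is_pullback C f g p q"
  shows "p \<in> hom C (Src C p) (Src C f)" "q \<in> hom C (Src C p) (Src C g)" "Cmp C f p = Cmp C g q"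
  using assms unfolding is_pullback_def by blast+

context category
begin

lemma hom_Ob:
  assumes "f \<in> hom C X Y"
  shows "X \<in> Ob C" "Y \<in> Ob C"
  using assms src_in_Ob tgt_in_Ob by (auto simp: hom_def)

text \<open>Composing the two projections with \<open>h\<close> gives a commuting cone, and both
  arrows mediate it.\<close>

lemma is_pullback_eqI:
  assumes pb: "is_pullback C f g p q"
    and h: "h \<in> hom C W (Src C p)" "h' \<in> hom C W (Src C p)"
    and eq: "Cmp C p h = Cmp C p h'" "Cmp C q h = Cmp C q h'"
  shows "h = h'"
proof -
  note pq = is_pullbackD[OF pb]
  have f: "f \<in> hom C (Src C f) (Tgt C f)" "g \<in> hom C (Src C g) (Tgt C f)"
    using pb by (auto simp: is_pullback_def hom_def)
  have "Cmp C f (Cmp C p h) = Cmp C g (Cmp C q h)"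
    using pq h f cmp_assoc[of h W "Src C p"] by metis
  with is_pullback_ex1[OF pb cmp_in_hom[OF h(1) pq(1)] cmp_in_hom[OF h(1) pq(2)]]
  show ?thesis using h eq by metis
qed

lemma slice_category: "category (slice C I)"
proof
  show "Src (slice C I) f \<in> Ob (slice C I)" "Tgt (slice C I) f \<in> Ob (slice C I)"
    if "f \<in> Ar (slice C I)" for f
    using that by (auto simp: slice_def)
  show "Ide (slice C I) X \<in> hom (slice C I) X X" if "X \<in> Ob (slice C I)" for X
    using that hom_Ob(1)[of X "Src C X" I]
    by (auto simp: slice_hom_iff slice_Ob_iff intro: ide_in_hom cmp_ide_right)
  show "Cmp (slice C I) g f \<in> hom (slice C I) X Z"
    if "f \<in> hom (slice C I) X Y" "g \<in> hom (slice C I) Y Z" for f g X Y Z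
    using that unfolding slice_hom_iff slice_Ob_iff
    by (auto intro: cmp_in_hom simp: cmp_assoc)
  show "Cmp (slice C I) (Ide (slice C I) Y) f = f" if "f \<in> hom (slice C I) X Y" for f X Y
    using slice_homD[OF that] by (cases f) (auto simp: cmp_ide_left)
  show "Cmp (slice C I) f (Ide (slice C I) X) = f" if "f \<in> hom (slice C I) X Y" for f X Y
    using slice_homD[OF that] by (cases f) (auto simp: cmp_ide_right)
  show "Cmp (slice C I) h (Cmp (slice C I) g f) = Cmp (slice C I) (Cmp (slice C I) h g) f"
    if "f \<in> hom (slice C I) W X" "g \<in> hom (slice C I) X Y" "h \<in> hom (slice C I) Y Z"
    for f g h W X Y Z
    using slice_homD[OF that(1)] slice_homD[OF that(2)] slice_homD[OF that(3)]
    by (auto simp: cmp_assoc)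
qed

text \<open>The empty product is the terminal object: an arrow from \<open>Q\<close> to the identity
  must have \<open>Q\<close> itself as its underlying arrow.\<close>

lemma slice_product_0:
  assumes I: "I \<in> Ob C"
  shows "is_product (slice C I) 0 X (Ide C I) \<pi>"
proof -
  have i: "Ide C I \<in> hom C I I" by (rule ide_in_hom[OF I])
  have "\<exists>!h. h \<in> hom (slice C I) Q (Ide C I)" if Q: "Q \<in> Ob (slice C I)" for Q
  proof
    show "Arrow Q (Ide C I) Q \<in> hom (slice C I) Q (Ide C I)"
      using Q i cmp_ide_left by (auto simp: slice_hom_iff slice_Ob_iff homE(2)[OF i])
    fix h assume h: "h \<in> hom (slice C I) Q (Ide C I)"
    note hD = slice_homD[OF h]
    have "underlying h = Q" using hD cmp_ide_left homE(2)[OF i] by metis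
    then show "h = Arrow Q (Ide C I) Q" using hD by (cases h) auto
  qed
  then show ?thesis
    using i by (auto simp: is_product_def slice_Ob_iff homE(2)[OF i])
qed

text \<open>A product over \<open>I\<close> is a fibre product over \<open>I\<close>. The apex of
  the pullback becomes an object of the slice through the composite along \<open>P\<close>, which
  equals the one along \<open>X n\<close>.\<close>

lemma slice_product_Suc:
  assumes prod: "is_product (slice C I) n X P \<pi>" and X: "X n \<in> Ob (slice C I)"
    and pb: "is_pullback C P (X n) r s"
  shows "is_product (slice C I) (Suc n) X (Cmp C P r)
           (\<lambda>i. if i < n then Cmp (slice C I) (\<pi> i) (Arrow (Cmp C P r) P r)
                else Arrow (Cmp C P r) (X n) s)"
    (is "is_product ?S _ _ ?R ?\<rho>")
proof -
  interpret S: category ?S by (rule slice_category)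
  have P: "P \<in> hom C (Src C P) I" and Xn: "X n \<in> hom C (Src C (X n)) I"
    using prod X by (auto simp: is_product_def slice_Ob_iff)
  note rs = is_pullbackD[OF pb]
  have R: "?R \<in> hom C (Src C r) I" by (rule cmp_in_hom[OF rs(1) P])
  have SR [simp]: "Src C ?R = Src C r" by (rule homE(2)[OF R])
  let ?r = "Arrow ?R P r" and ?s = "Arrow ?R (X n) s"
  have r: "?r \<in> hom ?S ?R P" using R P rs(1) by (simp add: slice_hom_iff slice_Ob_iff)
  have s: "?s \<in> hom ?S ?R (X n)" using R Xn rs(2) rs(3)[symmetric] by (simp add: slice_hom_iff slice_Ob_iff)
  have \<pi>: "\<pi> i \<in> hom ?S P (X i)" if "i < n" for i
    using prod that by (auto simp: is_product_def)
  have "\<exists>!h. h \<in> hom ?S Q ?R \<and> (\<forall>i<Suc n. Cmp ?S (?\<rho> i) h = \<sigma> i)"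
    if Q: "Q \<in> Ob ?S" and \<sigma>: "\<forall>i<Suc n. \<sigma> i \<in> hom ?S Q (X i)" for Q \<sigma>
  proof -
    have "\<exists>!h. h \<in> hom ?S Q P \<and> (\<forall>i<n. Cmp ?S (\<pi> i) h = \<sigma> i)"
      using prod Q \<sigma> by (auto simp: is_product_def simp del: slice_simps)
    then obtain g where g: "g \<in> hom ?S Q P" "\<And>i. i < n \<Longrightarrow> Cmp ?S (\<pi> i) g = \<sigma> i"
      and g_unique: "\<And>g'. g' \<in> hom ?S Q P \<Longrightarrow> (\<And>i. i < n \<Longrightarrow> Cmp ?S (\<pi> i) g' = \<sigma> i) \<Longrightarrow> g' = g"
      by metis
    have \<sigma>n: "\<sigma> n \<in> hom ?S Q (X n)" using \<sigma> by simp
    note gD = slice_homD[OF g(1)] and \<sigma>D = slice_homD[OF \<sigma>n]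
    obtain w where w: "w \<in> hom C (Src C Q) (Src C r)" "Cmp C r w = underlying g"
      "Cmp C s w = underlying (\<sigma> n)"
      using is_pullback_ex1[OF pb gD(5) \<sigma>D(5)] gD \<sigma>D by metis
    let ?w = "Arrow Q ?R w"
    have w_hom: "?w \<in> hom ?S Q ?R"
      using w Q R gD cmp_assoc[OF w(1) rs(1) P] by (simp add: slice_hom_iff slice_Ob_iff)
    have rw: "Cmp ?S ?r ?w = g" and sw: "Cmp ?S ?s ?w = \<sigma> n"
      using w(2,3) gD(1,2) \<sigma>D(1,2) by (auto intro!: arrow.expand)
    \<comment> \<open>Conditions on the first \<open>n\<close> projections become conditions on
      \<open>Cmp ?S ?r h\<close>, so uniqueness for \<open>P\<close> applies before uniqueness for
      the pullback.\<close>
    have factor: "Cmp ?S (?\<rho> i) h = Cmp ?S (\<pi> i) (Cmp ?S ?r h)"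
      if "i < n" "h \<in> hom ?S Q ?R" for i h
      using S.cmp_assoc[OF that(2) r \<pi>[OF that(1)]] that(1) by simp
    show ?thesis
    proof
      show "?w \<in> hom ?S Q ?R \<and> (\<forall>i<Suc n. Cmp ?S (?\<rho> i) ?w = \<sigma> i)"
      proof (intro conjI allI impI)
        fix i assume "i < Suc n"
        then consider "i < n" | "i = n" by linarith
        then show "Cmp ?S (?\<rho> i) ?w = \<sigma> i"
        proof cases
          case 1
          then show ?thesis using factor[OF 1 w_hom] rw g(2)[OF 1] by metis
        next
          case 2
          then show ?thesis using sw by simp
        qed
      qed (rule w_hom)
    next
      fix h assume h: "h \<in> hom ?S Q ?R \<and> (\<forall>i<Suc n. Cmp ?S (?\<rho> i) h = \<sigma> i)"
      then have hh: "h \<in> hom ?S Q ?R" by blast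
      have rh: "Cmp ?S ?r h = g"
      proof (rule g_unique)
        show "Cmp ?S ?r h \<in> hom ?S Q P" by (rule S.cmp_in_hom[OF hh r])
        show "Cmp ?S (\<pi> i) (Cmp ?S ?r h) = \<sigma> i" if "i < n" for i
          using factor[OF that hh] h that less_Suc_eq by metis
      qed
      have sh: "Cmp ?S ?s h = \<sigma> n"
        using h[THEN conjunct2, rule_format, OF lessI] by (simp only: less_irrefl if_False)
      have "Cmp C r (underlying h) = Cmp C r w" "Cmp C s (underlying h) = Cmp C s w"
        using arg_cong[OF rh, of underlying] arg_cong[OF sh, of underlying] w(2,3) by simp_all
      then have "underlying h = w"
        using is_pullback_eqI[OF pb _ w(1)] slice_homD(5)[OF hh] by simp
      then show "h = ?w" using slice_homD[OF hh] by (cases h) auto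
    qed
  qed
  moreover have "?\<rho> i \<in> hom ?S ?R (X i)" if "i < Suc n" for i
    using that s S.cmp_in_hom[OF r \<pi>] by (auto simp: less_Suc_eq simp del: slice_simps)
  ultimately show ?thesis
    using R by (auto simp: is_product_def slice_Ob_iff simp del: slice_simps)
qed

lemma slice_has_finite_products:
  assumes I: "I \<in> Ob C"
    and pullbacks: "\<And>f g. f \<in> Ar C \<Longrightarrow> g \<in> Ar C \<Longrightarrow> Tgt C f = Tgt C g \<Longrightarrow> \<exists>p q. is_pullback C f g p q"
  shows "has_finite_products (slice C I)"
proof -
  have "\<exists>P \<pi>. is_product (slice C I) n X P \<pi>" if "\<forall>i<n. X i \<in> Ob (slice C I)" for n X
    using that
  proof (induction n)
    case 0
    then show ?case using slice_product_0[OF I] by blast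
  next
    case (Suc n)
    then obtain P \<pi> where prod: "is_product (slice C I) n X P \<pi>" by auto
    then have "P \<in> Ob (slice C I)" by (simp add: is_product_def)
    with Suc.prems obtain r s where "is_pullback C P (X n) r s"
      using pullbacks[of P "X n"] by (auto simp: slice_def)
    then show ?case using slice_product_Suc[OF prod] Suc.prems by blast
  qed
  then show ?thesis by (simp add: has_finite_products_def)
qed

end

section \<open>The later functor and next on a slice, for an arbitrary pointed endofunctor\<close>

locale pointed_endofunctor = category C
  for C :: "('o, 'm) cat" and L :: "('o, 'm, 'o, 'm) fctr" and \<nu> :: "'o \<Rightarrow> 'm" and I :: 'o +
  assumes nat: "is_nat_trans C C id_fctr L \<nu>"
    and pullbacks: "\<And>f g. f \<in> Ar C \<Longrightarrow> g \<in> Ar C \<Longrightarrow> Tgt C f = Tgt C g \<Longrightarrow> \<exists>p q. is_pullback C f g p q"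
    and base: "I \<in> Ob C"
begin

abbreviation slice_later_fst :: "'m \<Rightarrow> 'm" where
  "slice_later_fst p \<equiv> fst (slice_pullback C L \<nu> I p)"

abbreviation slice_later_snd :: "'m \<Rightarrow> 'm" where
  "slice_later_snd p \<equiv> snd (slice_pullback C L \<nu> I p)"

lemma L_functor: "is_functor C C L"
  using nat by (simp add: is_nat_trans_def)

lemma L_hom: "f \<in> hom C X Y \<Longrightarrow> on_Ar L f \<in> hom C (on_Ob L X) (on_Ob L Y)"
  using L_functor by (simp add: is_functor_def)

lemma L_cmp: "f \<in> hom C X Y \<Longrightarrow> g \<in> hom C Y Z \<Longrightarrow> on_Ar L (Cmp C g f) = Cmp C (on_Ar L g) (on_Ar L f)"
  using L_functor unfolding is_functor_def by blast

lemma L_ide: "X \<in> Ob C \<Longrightarrow> on_Ar L (Ide C X) = Ide C (on_Ob L X)"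
  using L_functor by (simp add: is_functor_def)

lemma \<nu>_hom: "X \<in> Ob C \<Longrightarrow> \<nu> X \<in> hom C X (on_Ob L X)"
  using nat by (simp add: is_nat_trans_def id_fctr_def)

lemma \<nu>_natural: "f \<in> hom C X Y \<Longrightarrow> Cmp C (\<nu> Y) f = Cmp C (on_Ar L f) (\<nu> X)"
  using nat by (simp add: is_nat_trans_def id_fctr_def)

text \<open>\<open>SOME\<close> picks a pullback because one exists. This is all that is known about
  the chosen projections.\<close>

lemma slice_pullback:
  assumes "p \<in> hom C Y I"
  shows "is_pullback C (\<nu> I) (on_Ar L p) (slice_later_fst p) (slice_later_snd p)"
proof -
  have "\<exists>r s. is_pullback C (\<nu> I) (on_Ar L p) r s"
    using pullbacks[of "\<nu> I" "on_Ar L p"] L_hom[OF assms] \<nu>_hom[OF base] by (auto simp: hom_def)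
  then have "\<exists>rs. case rs of (r, s) \<Rightarrow> is_pullback C (\<nu> I) (on_Ar L p) r s" by simp
  then have "case slice_pullback C L \<nu> I p of (r, s) \<Rightarrow> is_pullback C (\<nu> I) (on_Ar L p) r s"
    unfolding slice_pullback_def by (rule someI_ex)
  then show ?thesis by (simp add: case_prod_beta)
qed

lemma slice_later_square:
  assumes p: "p \<in> hom C Y I"
  shows "slice_later_fst p \<in> hom C (Src C (slice_later_fst p)) I"
    "slice_later_snd p \<in> hom C (Src C (slice_later_fst p)) (on_Ob L Y)"
    "Cmp C (\<nu> I) (slice_later_fst p) = Cmp C (on_Ar L p) (slice_later_snd p)"
  using is_pullbackD[OF slice_pullback[OF p]] homE(2)[OF \<nu>_hom[OF base]] homE(2)[OF L_hom[OF p]]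
  by simp_all

text \<open>The projections are jointly monic. The functor laws and naturality on the slice are
  checked on them.\<close>

lemma slice_later_eqI:
  assumes "p \<in> hom C Y I"
    and "h \<in> hom C W (Src C (slice_later_fst p))" "h' \<in> hom C W (Src C (slice_later_fst p))"
    and "Cmp C (slice_later_fst p) h = Cmp C (slice_later_fst p) h'"
    and "Cmp C (slice_later_snd p) h = Cmp C (slice_later_snd p) h'"
  shows "h = h'"
  by (rule is_pullback_eqI[OF slice_pullback]) fact+

lemma slice_later_Ob: "on_Ob (slice_later C L \<nu> I) p = slice_later_fst p"
  by (simp add: slice_later_def)

text \<open>The description by \<open>THE\<close> is legitimate: \<open>L q\<close> after the image
  of \<open>f\<close> is \<open>L p\<close>, so the square for \<open>p\<close> supplies a cone over
  the square for \<open>q\<close>.\<close>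

lemma slice_later_Ar:
  assumes f: "f \<in> hom (slice C I) p q"
  shows "on_Ar (slice_later C L \<nu> I) f \<in> hom (slice C I) (slice_later_fst p) (slice_later_fst q)"
    and "Cmp C (slice_later_snd q) (underlying (on_Ar (slice_later C L \<nu> I) f)) =
           Cmp C (on_Ar L (underlying f)) (slice_later_snd p)"
proof -
  note fD = slice_homD[OF f]
  note P = slice_later_square[OF fD(3)] and Q = slice_later_square[OF fD(4)]
  note Lf = L_hom[OF fD(5)]
  let ?P = "\<lambda>w. w \<in> hom C (Src C (slice_later_fst p)) (Src C (slice_later_fst q)) \<and>
    Cmp C (slice_later_fst q) w = slice_later_fst p \<and>
    Cmp C (slice_later_snd q) w = Cmp C (on_Ar L (underlying f)) (slice_later_snd p)"
  have "Cmp C (\<nu> I) (slice_later_fst p) =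
      Cmp C (on_Ar L q) (Cmp C (on_Ar L (underlying f)) (slice_later_snd p))"
    using P L_cmp[OF fD(5) fD(4)] fD(6) cmp_assoc[OF P(2) Lf L_hom[OF fD(4)]] by simp
  then have "\<exists>!w. ?P w"
    using is_pullback_ex1[OF slice_pullback[OF fD(4)], of "slice_later_fst p"
        "Src C (slice_later_fst p)" "Cmp C (on_Ar L (underlying f)) (slice_later_snd p)"]
      P cmp_in_hom[OF P(2) Lf] homE(2)[OF \<nu>_hom[OF base]] homE(2)[OF L_hom[OF fD(4)]]
    by simp
  then have w: "?P (The ?P)" by (rule theI')
  have eq: "on_Ar (slice_later C L \<nu> I) f = Arrow (slice_later_fst p) (slice_later_fst q) (The ?P)"
    by (simp add: slice_later_def case_prod_beta fD)
  show "on_Ar (slice_later C L \<nu> I) f \<in> hom (slice C I) (slice_later_fst p) (slice_later_fst q)"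
    "Cmp C (slice_later_snd q) (underlying (on_Ar (slice_later C L \<nu> I) f)) =
           Cmp C (on_Ar L (underlying f)) (slice_later_snd p)"
    unfolding eq slice_hom_iff slice_Ob_iff using w P(1) Q(1) by simp_all
qed

text \<open>The triangle over \<open>I\<close> is part of being an arrow of the slice, so the second
  projection alone decides.\<close>

lemma slice_later_Ar_eqI:
  assumes f: "f \<in> hom (slice C I) p q"
    and g: "g \<in> hom (slice C I) (slice_later_fst p) (slice_later_fst q)"
    and eq: "Cmp C (slice_later_snd q) (underlying g) =
           Cmp C (on_Ar L (underlying f)) (slice_later_snd p)"
  shows "on_Ar (slice_later C L \<nu> I) f = g"
proof (rule slice_arrow_eqI[OF slice_later_Ar(1)[OF f] g])
  note fD = slice_homD[OF slice_later_Ar(1)[OF f]] and gD = slice_homD[OF g]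
  show "underlying (on_Ar (slice_later C L \<nu> I) f) = underlying g"
    by (rule slice_later_eqI[OF slice_homD(4)[OF f] fD(5) gD(5)])
      (simp_all add: fD(6) gD(6) eq slice_later_Ar(2)[OF f])
qed

lemma slice_later_functor: "is_functor (slice C I) (slice C I) (slice_later C L \<nu> I)"
proof -
  interpret S: category "slice C I" by (rule slice_category)
  have ob: "slice_later_fst p \<in> Ob (slice C I)" if "p \<in> Ob (slice C I)" for p
    using slice_later_square(1) that by (auto simp: slice_Ob_iff)
  have ide: "on_Ar (slice_later C L \<nu> I) (Ide (slice C I) p) = Ide (slice C I) (slice_later_fst p)"
    if p: "p \<in> Ob (slice C I)" for p
  proof (rule slice_later_Ar_eqI[OF S.ide_in_hom[OF p] S.ide_in_hom[OF ob[OF p]]])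
    have p': "p \<in> hom C (Src C p) I" using p by (simp add: slice_Ob_iff)
    note P = slice_later_square[OF p'] and pO = hom_Ob(1)[OF p']
    show "Cmp C (slice_later_snd p) (underlying (Ide (slice C I) (slice_later_fst p))) =
      Cmp C (on_Ar L (underlying (Ide (slice C I) p))) (slice_later_snd p)"
      using cmp_ide_right[OF P(2)] cmp_ide_left[OF P(2)] L_ide[OF pO] by simp
  qed
  have cmp: "on_Ar (slice_later C L \<nu> I) (Cmp (slice C I) g f) =
      Cmp (slice C I) (on_Ar (slice_later C L \<nu> I) g) (on_Ar (slice_later C L \<nu> I) f)"
    if f: "f \<in> hom (slice C I) X Y" and g: "g \<in> hom (slice C I) Y Z" for f g X Y Z
  proof (rule slice_later_Ar_eqI[OF S.cmp_in_hom[OF f g]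
        S.cmp_in_hom[OF slice_later_Ar(1)[OF f] slice_later_Ar(1)[OF g]]])
    note fD = slice_homD[OF f] and gD = slice_homD[OF g]
    note fD' = slice_homD[OF slice_later_Ar(1)[OF f]] and gD' = slice_homD[OF slice_later_Ar(1)[OF g]]
    note X = slice_later_square[OF fD(3)] and Y = slice_later_square[OF fD(4)]
      and Z = slice_later_square[OF gD(4)]
    show "Cmp C (slice_later_snd Z)
        (underlying (Cmp (slice C I) (on_Ar (slice_later C L \<nu> I) g) (on_Ar (slice_later C L \<nu> I) f))) =
      Cmp C (on_Ar L (underlying (Cmp (slice C I) g f))) (slice_later_snd X)"
      using cmp_assoc[OF fD'(5) gD'(5) Z(2)] cmp_assoc[OF fD'(5) Y(2) L_hom[OF gD(5)]]
        cmp_assoc[OF X(2) L_hom[OF fD(5)] L_hom[OF gD(5)]]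
        slice_later_Ar(2)[OF f] slice_later_Ar(2)[OF g] L_cmp[OF fD(5) gD(5)]
      by simp
  qed
  show ?thesis
    using S.category_axioms ob slice_later_Ar(1) ide cmp
    unfolding is_functor_def slice_later_Ob by blast
qed

text \<open>Naturality of \<open>\<nu>\<close> at \<open>p\<close> is what makes \<open>p\<close>
  and \<open>\<nu> Y\<close> a cone over the pullback square.\<close>

lemma slice_next_arrow:
  assumes p: "p \<in> hom C Y I"
  shows "slice_next C L \<nu> I p \<in> hom (slice C I) p (slice_later_fst p)"
    and "Cmp C (slice_later_snd p) (underlying (slice_next C L \<nu> I p)) = \<nu> Y"
proof -
  note P = slice_later_square[OF p] and Y = hom_Ob(1)[OF p] and SY = homE(2)[OF p]
  let ?P = "\<lambda>w. w \<in> hom C Y (Src C (slice_later_fst p)) \<and>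
    Cmp C (slice_later_fst p) w = p \<and> Cmp C (slice_later_snd p) w = \<nu> Y"
  have "\<exists>!w. ?P w"
    using is_pullback_ex1[OF slice_pullback[OF p], of p Y "\<nu> Y"] p \<nu>_natural[OF p] \<nu>_hom[OF Y]
      homE(2)[OF \<nu>_hom[OF base]] homE(2)[OF L_hom[OF p]]
    by simp
  then have w: "?P (The ?P)" by (rule theI')
  have eq: "slice_next C L \<nu> I p = Arrow p (slice_later_fst p) (The ?P)"
    by (simp add: slice_next_def case_prod_beta SY)
  show "slice_next C L \<nu> I p \<in> hom (slice C I) p (slice_later_fst p)"
    "Cmp C (slice_later_snd p) (underlying (slice_next C L \<nu> I p)) = \<nu> Y"
    unfolding eq slice_hom_iff slice_Ob_iff using w P(1) p SY by simp_all
qed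

text \<open>On the first projection both composites give \<open>p\<close>, by the triangles over
  \<open>I\<close>; on the second the equation is naturality of \<open>\<nu>\<close>.\<close>

lemma slice_next_natural:
  "is_nat_trans (slice C I) (slice C I) id_fctr (slice_later C L \<nu> I) (slice_next C L \<nu> I)"
proof -
  interpret S: category "slice C I" by (rule slice_category)
  have "is_functor (slice C I) (slice C I) id_fctr"
    using S.category_axioms by (simp add: is_functor_def id_fctr_def)
  moreover have "Cmp (slice C I) (slice_next C L \<nu> I q) f =
      Cmp (slice C I) (on_Ar (slice_later C L \<nu> I) f) (slice_next C L \<nu> I p)"
    if f: "f \<in> hom (slice C I) p q" for p q f
  proof -
    note fD = slice_homD[OF f] and F = slice_later_Ar(1)[OF f]
    note p = slice_next_arrow[OF fD(3)] and q = slice_next_arrow[OF fD(4)]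
    note P = slice_later_square[OF fD(3)] and Q = slice_later_square[OF fD(4)]
    note l = S.cmp_in_hom[OF f q(1)] and r = S.cmp_in_hom[OF p(1) F]
    note pD = slice_homD[OF p(1)] and qD = slice_homD[OF q(1)] and FD = slice_homD[OF F]
    show ?thesis
    proof (rule slice_arrow_eqI[OF l r], rule slice_later_eqI[OF fD(4) slice_homD(5)[OF l] slice_homD(5)[OF r]])
      show "Cmp C (slice_later_fst q) (underlying (Cmp (slice C I) (slice_next C L \<nu> I q) f)) =
        Cmp C (slice_later_fst q)
          (underlying (Cmp (slice C I) (on_Ar (slice_later C L \<nu> I) f) (slice_next C L \<nu> I p)))"
        using slice_homD(6)[OF l] slice_homD(6)[OF r] by simp
      show "Cmp C (slice_later_snd q) (underlying (Cmp (slice C I) (slice_next C L \<nu> I q) f)) =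
        Cmp C (slice_later_snd q)
          (underlying (Cmp (slice C I) (on_Ar (slice_later C L \<nu> I) f) (slice_next C L \<nu> I p)))"
        using cmp_assoc[OF fD(5) qD(5) Q(2)] cmp_assoc[OF pD(5) FD(5) Q(2)]
          cmp_assoc[OF pD(5) P(2) L_hom[OF fD(5)]] p(2) q(2) slice_later_Ar(2)[OF f] \<nu>_natural[OF fD(5)]
        by simp
    qed
  qed
  ultimately show ?thesis
    using slice_later_functor slice_next_arrow(1)
    by (simp add: is_nat_trans_def id_fctr_def slice_later_Ob slice_Ob_iff del: slice_simps)
qed

end

lemma is_functor_comp:
  assumes F: "is_functor C D F" and G: "is_functor D E G"
  shows "is_functor C E (comp_fctr G F)"
proof -
  have "on_Ar G (on_Ar F (Cmp C g f)) = Cmp E (on_Ar G (on_Ar F g)) (on_Ar G (on_Ar F f))"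
    if "f \<in> hom C X Y" "g \<in> hom C Y Z" for X Y Z f g
  proof -
    have "on_Ar F f \<in> hom D (on_Ob F X) (on_Ob F Y)" "on_Ar F g \<in> hom D (on_Ob F Y) (on_Ob F Z)"
      "on_Ar F (Cmp C g f) = Cmp D (on_Ar F g) (on_Ar F f)"
      using F that unfolding is_functor_def by blast+
    then show ?thesis using G unfolding is_functor_def by metis
  qed
  then show ?thesis using F G by (simp add: is_functor_def comp_fctr_def)
qed

lemma functor_preserves_cone:
  assumes E: "is_functor J C E" and F: "is_functor C D F" and c: "is_cone J C E L \<pi>"
  shows "is_cone J D (comp_fctr F E) (on_Ob F L) (\<lambda>i. on_Ar F (\<pi> i))"
proof -
  interpret J: category J using E by (simp add: is_functor_def)
  have "Cmp D (on_Ar F (on_Ar E u)) (on_Ar F (\<pi> i)) = on_Ar F (\<pi> j)" if u: "u \<in> hom J i j" for i j u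
  proof -
    have "\<pi> i \<in> hom C L (on_Ob E i)" "on_Ar E u \<in> hom C (on_Ob E i) (on_Ob E j)"
      "Cmp C (on_Ar E u) (\<pi> i) = \<pi> j"
      using c E u J.hom_Ob[OF u] by (auto simp: is_cone_def is_functor_def)
    then show ?thesis using F unfolding is_functor_def by metis
  qed
  then show ?thesis using c F by (auto simp: is_cone_def is_functor_def comp_fctr_def)
qed

section \<open>The categories of presheaves and sheaves\<close>

lemma PSh_simps [simp]:
  "Ob PSh = {X. is_presheaf X}" "Src PSh = source" "Tgt PSh = target"
  by (simp_all add: PSh_def)

lemma Sh_simps [simp]:
  "Ob Sh = {X. is_sheaf X}" "Src Sh = source" "Tgt Sh = target"
  "Ide Sh = Ide PSh" "Cmp Sh = Cmp PSh"
  by (simp_all add: Sh_def PSh_def)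

lemma PSh_ide [simp]:
  "source (Ide PSh X) = X" "target (Ide PSh X) = X"
  "x \<in> sec X a \<Longrightarrow> underlying (Ide PSh X) a x = x"
  by (simp_all add: PSh_def)

lemma PSh_cmp [simp]:
  "source (Cmp PSh g f) = source f" "target (Cmp PSh g f) = target g"
  "x \<in> sec (source f) a \<Longrightarrow> underlying (Cmp PSh g f) a x = underlying g a (underlying f a x)"
  by (simp_all add: PSh_def compose_def)

lemma PSh_hom_iff:
  "f \<in> hom PSh X Y \<longleftrightarrow>
     source f = X \<and> target f = Y \<and> is_presheaf X \<and> is_presheaf Y \<and>
     (\<forall>a. underlying f a \<in> sec X a \<rightarrow>\<^sub>E sec Y a) \<and>
     (\<forall>a b. b \<le> a \<longrightarrow> (\<forall>x\<in>sec X a. res Y a b (underlying f a x) = underlying f b (res X a b x)))"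
  by (cases f) (auto simp: hom_def PSh_def presheaf_arrows_def)

lemma PSh_homD:
  assumes "f \<in> hom PSh X Y"
  shows "source f = X" "target f = Y" "is_presheaf X" "is_presheaf Y"
    "x \<in> sec X a \<Longrightarrow> underlying f a x \<in> sec Y a"
    "b \<le> a \<Longrightarrow> x \<in> sec X a \<Longrightarrow> res Y a b (underlying f a x) = underlying f b (res X a b x)"
  using assms PiE_mem unfolding PSh_hom_iff by fast+

text \<open>Components are extensional, so agreement on sections is agreement everywhere.\<close>

lemma PSh_hom_eqI:
  assumes "f \<in> hom PSh X Y" "g \<in> hom PSh X Y"
    and "\<And>a x. x \<in> sec X a \<Longrightarrow> underlying f a x = underlying g a x"
  shows "f = g"
proof (rule arrow.expand, intro conjI)
  have "underlying f a = underlying g a" for a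
    by (rule PiE_ext[where k = "sec X a" and s = "\<lambda>_. sec Y a"])
      (use assms in \<open>auto simp: PSh_hom_iff\<close>)
  then show "underlying f = underlying g" by blast
qed (use assms in \<open>simp_all add: PSh_hom_iff\<close>)

lemma is_sheaf_presheaf: "is_sheaf X \<Longrightarrow> is_presheaf X"
  by (simp add: is_sheaf_def)

lemma Sh_hom_iff: "f \<in> hom Sh X Y \<longleftrightarrow> f \<in> hom PSh X Y \<and> is_sheaf X \<and> is_sheaf Y"
  by (auto simp: hom_def Sh_def PSh_def)

lemma Sh_homD:
  assumes "f \<in> hom Sh X Y"
  shows "source f = X" "target f = Y" "is_sheaf X" "is_sheaf Y" "f \<in> hom PSh X Y"
    "x \<in> sec X a \<Longrightarrow> underlying f a x \<in> sec Y a"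
    "b \<le> a \<Longrightarrow> x \<in> sec X a \<Longrightarrow> res Y a b (underlying f a x) = underlying f b (res X a b x)"
  using assms PSh_homD[of f X Y] by (simp_all add: Sh_hom_iff)

lemma Sh_hom_eqI:
  assumes "f \<in> hom Sh X Y" "g \<in> hom Sh X Y"
    and "\<And>a x. x \<in> sec X a \<Longrightarrow> underlying f a x = underlying g a x"
  shows "f = g"
  by (rule PSh_hom_eqI[of f X Y g]) (use assms in \<open>simp_all add: Sh_hom_iff\<close>)

text \<open>Cutting \<open>\<phi>\<close> down to the sections makes the components extensional, as
  \<open>presheaf_arrows\<close> requires.\<close>

definition psh_map ::
  "('a :: order, 'u) presheaf \<Rightarrow> ('a, 'u) presheaf \<Rightarrow> ('a \<Rightarrow> 'u \<Rightarrow> 'u) \<Rightarrow> ('a, 'u) psh_arrow" where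
  "psh_map X Y \<phi> = Arrow X Y (\<lambda>a. \<lambda>x\<in>sec X a. \<phi> a x)"

lemma psh_map_simps [simp]:
  "source (psh_map X Y \<phi>) = X" "target (psh_map X Y \<phi>) = Y"
  "x \<in> sec X a \<Longrightarrow> underlying (psh_map X Y \<phi>) a x = \<phi> a x"
  by (simp_all add: psh_map_def)

lemma res_in: "is_presheaf X \<Longrightarrow> b \<le> a \<Longrightarrow> x \<in> sec X a \<Longrightarrow> res X a b x \<in> sec X b"
  by (auto simp: is_presheaf_def)

lemma res_id: "is_presheaf X \<Longrightarrow> x \<in> sec X a \<Longrightarrow> res X a a x = x"
  by (auto simp: is_presheaf_def)

lemma res_res:
  "is_presheaf X \<Longrightarrow> c \<le> b \<Longrightarrow> b \<le> a \<Longrightarrow> x \<in> sec X a \<Longrightarrow> res X b c (res X a b x) = res X a c x"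
  by (auto simp: is_presheaf_def)

lemma psh_map_hom:
  assumes "is_presheaf X" "is_presheaf Y"
    and "\<And>a x. x \<in> sec X a \<Longrightarrow> \<phi> a x \<in> sec Y a"
    and "\<And>a b x. b \<le> a \<Longrightarrow> x \<in> sec X a \<Longrightarrow> res Y a b (\<phi> a x) = \<phi> b (res X a b x)"
  shows "psh_map X Y \<phi> \<in> hom PSh X Y"
  using assms by (auto simp: PSh_hom_iff psh_map_def res_in)

lemma PSh_category: "category PSh"
proof
  show "Src PSh f \<in> Ob PSh" "Tgt PSh f \<in> Ob PSh" if "f \<in> Ar PSh" for f :: "('a, 'u) psh_arrow"
    using that by (auto simp: PSh_def presheaf_arrows_def)
  show ide: "Ide PSh X \<in> hom PSh X X" if "X \<in> Ob PSh" for X :: "('a, 'u) presheaf"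
    using that by (auto simp: PSh_hom_iff res_in) (simp add: PSh_def)+
  show cmp: "Cmp PSh g f \<in> hom PSh X Z" if f: "f \<in> hom PSh X Y" and g: "g \<in> hom PSh Y Z"
    for f g :: "('a, 'u) psh_arrow" and X Y Z
  proof -
    note fD = PSh_homD[OF f] and gD = PSh_homD[OF g]
    have "underlying (Cmp PSh g f) a \<in> sec X a \<rightarrow>\<^sub>E sec Z a" for a
      using fD gD by (auto simp: PSh_def compose_def)
    then show ?thesis using fD gD by (auto simp: PSh_hom_iff res_in)
  qed
  show "Cmp PSh (Ide PSh Y) f = f" if f: "f \<in> hom PSh X Y" for f :: "('a, 'u) psh_arrow" and X Y
    using PSh_homD[OF f] by (intro PSh_hom_eqI[OF cmp[OF f ide] f]) auto
  show "Cmp PSh f (Ide PSh X) = f" if f: "f \<in> hom PSh X Y" for f :: "('a, 'u) psh_arrow" and X Y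
    using PSh_homD[OF f] by (intro PSh_hom_eqI[OF cmp[OF ide f] f]) auto
  show "Cmp PSh h (Cmp PSh g f) = Cmp PSh (Cmp PSh h g) f"
    if f: "f \<in> hom PSh W X" and g: "g \<in> hom PSh X Y" and h: "h \<in> hom PSh Y Z"
    for f g h :: "('a, 'u) psh_arrow" and W X Y Z
    using PSh_homD[OF f] PSh_homD[OF g] PSh_homD[OF h]
    by (intro PSh_hom_eqI[OF cmp[OF cmp[OF f g] h] cmp[OF f cmp[OF g h]]]) auto
qed

lemma Sh_category: "category Sh"
proof -
  interpret P: category PSh by (rule PSh_category)
  show ?thesis
  proof
    show "Src Sh f \<in> Ob Sh" "Tgt Sh f \<in> Ob Sh" if "f \<in> Ar Sh" for f :: "('a, 'u) psh_arrow"
      using that by (auto simp: Sh_def PSh_def)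
    show "Ide Sh X \<in> hom Sh X X" if "X \<in> Ob Sh" for X :: "('a, 'u) presheaf"
      using that P.ide_in_hom[of X] by (simp add: Sh_hom_iff is_sheaf_presheaf)
  qed (auto simp: Sh_hom_iff intro: P.cmp_in_hom P.cmp_ide_left P.cmp_ide_right P.cmp_assoc)
qed

text \<open>The restrictions of \<open>x\<close> form a compatible family on \<open>B\<close>, and
  both sections glue it.\<close>

lemma sheaf_eqI:
  assumes X: "is_sheaf X" and xy: "x \<in> sec X (Sup B)" "y \<in> sec X (Sup B)"
    and eq: "\<And>b. b \<in> B \<Longrightarrow> res X (Sup B) b x = res X (Sup B) b y"
  shows "x = y"
proof -
  have pX: "is_presheaf X" by (rule is_sheaf_presheaf[OF X])
  have "\<exists>!z. z \<in> sec X (Sup B) \<and> (\<forall>b\<in>B. res X (Sup B) b z = res X (Sup B) b x)"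
    using X[unfolded is_sheaf_def, THEN conjunct2, rule_format, of B "\<lambda>b. res X (Sup B) b x"]
      res_in[OF pX Sup_upper xy(1)] res_res[OF pX inf_le1 Sup_upper xy(1)]
      res_res[OF pX inf_le2 Sup_upper xy(1)]
    by simp
  then show ?thesis using xy eq by metis
qed

lemma sheaf_glue:
  assumes X: "is_sheaf X" and z: "\<And>b. b \<in> B \<Longrightarrow> z b \<in> sec X b"
    and eq: "\<And>b c. b \<in> B \<Longrightarrow> c \<in> B \<Longrightarrow> res X b (inf b c) (z b) = res X c (inf b c) (z c)"
  shows "\<exists>x \<in> sec X (Sup B). \<forall>b\<in>B. res X (Sup B) b x = z b"
  using X[unfolded is_sheaf_def, THEN conjunct2, rule_format, of B z] z eq by blast

text \<open>Sections over \<open>a\<close> correspond to maps out of the representable sheaf at \<open>a\<close>, which is how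
  universal properties in \<open>Sh\<close> are evaluated at sections.\<close>

definition representable :: "'a :: complete_heyting_algebra \<Rightarrow> ('a, 'u) presheaf" where
  "representable a = \<lparr>sec = (\<lambda>b. if b \<le> a then {undefined} else {}), res = (\<lambda>_ _ x. x)\<rparr>"

lemma sec_representable: "x \<in> sec (representable a) b \<longleftrightarrow> b \<le> a \<and> x = undefined"
  by (simp add: representable_def)

lemma res_representable [simp]: "res (representable a) b c x = x"
  by (simp add: representable_def)

text \<open>A family on \<open>B\<close> exists only if every member of \<open>B\<close> is below
  \<open>a\<close>, and then \<open>Sup B\<close> is below \<open>a\<close> too.\<close>

lemma representable_sheaf: "is_sheaf (representable a)"
  unfolding is_sheaf_def
proof (intro conjI allI impI)
  show "is_presheaf (representable a)"
    by (auto simp: is_presheaf_def sec_representable intro: order_trans)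
  fix B :: "'a set" and x
  assume "\<forall>b\<in>B. x b \<in> sec (representable a) b"
  then show "\<exists>!y. y \<in> sec (representable a) (Sup B) \<and> (\<forall>b\<in>B. res (representable a) (Sup B) b y = x b)"
    by (auto simp: sec_representable intro: Sup_least)
qed

definition section_map ::
  "('a :: complete_heyting_algebra, 'u) presheaf \<Rightarrow> 'a \<Rightarrow> 'u \<Rightarrow> ('a, 'u) psh_arrow" where
  "section_map X a x = psh_map (representable a) X (\<lambda>b _. res X a b x)"

lemma section_map_apply: "b \<le> a \<Longrightarrow> underlying (section_map X a x) b undefined = res X a b x"
  by (simp add: section_map_def sec_representable)

lemma section_map_hom:
  assumes "is_sheaf X" "x \<in> sec X a"
  shows "section_map X a x \<in> hom Sh (representable a) X"
  unfolding section_map_def Sh_hom_iff using assms representable_sheaf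
  by (auto intro!: psh_map_hom simp: sec_representable res_res res_in is_sheaf_presheaf)

lemma section_map_source [simp]: "source (section_map X a x) = representable a"
  by (simp add: section_map_def)

lemma section_map_cmp:
  assumes f: "f \<in> hom Sh X Y" and x: "x \<in> sec X a"
  shows "Cmp Sh f (section_map X a x) = section_map Y a (underlying f a x)"
proof -
  interpret category Sh by (rule Sh_category)
  note fD = Sh_homD[OF f]
  show ?thesis
    by (rule Sh_hom_eqI[OF cmp_in_hom[OF section_map_hom f] section_map_hom])
      (use fD x in \<open>auto simp: sec_representable section_map_apply\<close>)
qed

text \<open>Yoneda: the component at \<open>b\<close> is forced by naturality along
  \<open>b \<le> a\<close>, starting from the only section over \<open>a\<close>.\<close>

lemma hom_representable:
  assumes h: "h \<in> hom Sh (representable a) X"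
  shows "h = section_map X a (underlying h a undefined)"
    and "underlying h a undefined \<in> sec X a"
proof -
  note hD = Sh_homD[OF h]
  show mem: "underlying h a undefined \<in> sec X a" using hD(6) by (simp add: sec_representable)
  show "h = section_map X a (underlying h a undefined)"
    by (rule Sh_hom_eqI[OF h section_map_hom[OF hD(4) mem]])
      (auto simp: sec_representable section_map_apply hD(7))
qed

lemma section_map_inject:
  assumes "is_sheaf X" "x \<in> sec X a" "y \<in> sec X a" "section_map X a x = section_map X a y"
  shows "x = y"
  using assms section_map_apply[OF order_refl, of X a] res_id[OF is_sheaf_presheaf[OF assms(1)]]
  by metis

text \<open>Sections over \<open>a\<close> are maps out of \<open>representable a\<close>, so the
  universal property tested on that one object describes the sections of a pullback of which nothing
  else is known.\<close>

lemma Sh_pullback_sections: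
  assumes pb: "is_pullback Sh f g p q"
    and x: "x \<in> sec (source f) a" and y: "y \<in> sec (source g) a"
    and eq: "underlying f a x = underlying g a y"
  shows "\<exists>!w. w \<in> sec (source p) a \<and> underlying p a w = x \<and> underlying q a w = y"
proof -
  interpret category Sh by (rule Sh_category)
  have f: "f \<in> hom Sh (source f) (target f)" "g \<in> hom Sh (source g) (target f)"
    using pb by (auto simp: is_pullback_def hom_def)
  note fD = Sh_homD[OF f(1)] and gD = Sh_homD[OF f(2)]
  have pq: "p \<in> hom Sh (source p) (source f)" "q \<in> hom Sh (source p) (source g)"
    using is_pullbackD[OF pb] by simp_all
  note pD = Sh_homD[OF pq(1)]
  let ?x = "section_map (source f) a x" and ?y = "section_map (source g) a y"
  have "Cmp Sh f ?x = Cmp Sh g ?y"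
    using section_map_cmp[OF f(1) x] section_map_cmp[OF f(2) y] eq by simp
  moreover have xy: "?x \<in> hom Sh (representable a) (source f)" "?y \<in> hom Sh (representable a) (source g)"
    using fD gD x y by (auto intro!: section_map_hom)
  ultimately obtain h where h: "h \<in> hom Sh (representable a) (source p)" "Cmp Sh p h = ?x" "Cmp Sh q h = ?y"
    using is_pullback_ex1[OF pb, of ?x "representable a" ?y] by auto
  note hD = Sh_homD[OF h(1)]
  \<comment> \<open>By injectivity of \<open>section_map\<close>, the two equations on sections are
    the two triangles of the universal property.\<close>
  have app: "underlying p a w = x \<and> underlying q a w = y \<longleftrightarrow>
      Cmp Sh p (section_map (source p) a w) = ?x \<and> Cmp Sh q (section_map (source p) a w) = ?y"
    if w: "w \<in> sec (source p) a" for w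
    unfolding section_map_cmp[OF pq(1) w] section_map_cmp[OF pq(2) w]
    using section_map_inject[OF fD(3) Sh_homD(6)[OF pq(1) w] x]
      section_map_inject[OF gD(3) Sh_homD(6)[OF pq(2) w] y] by metis
  show ?thesis
  proof
    let ?w = "underlying h a undefined"
    note w = hom_representable[OF h(1)]
    show "?w \<in> sec (source p) a \<and> underlying p a ?w = x \<and> underlying q a ?w = y"
      using app[OF w(2)] w h by metis
    fix w' assume w': "w' \<in> sec (source p) a \<and> underlying p a w' = x \<and> underlying q a w' = y"
    then have "section_map (source p) a w' = h"
      using app[of w'] h is_pullback_eqI[OF pb, of "section_map (source p) a w'" "representable a" h]
        section_map_hom[OF pD(3)] by auto
    then show "w' = ?w" using section_map_inject[OF pD(3)] w w' by metis
  qed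
qed

text \<open>Fibre products are formed section by section, but pairs have to be elements of
  \<open>'u\<close> again. An infinite type embeds its own square, which supplies the coding
  \<open>pr\<close>.\<close>

lemma Sh_pullback_exists:
  fixes f g :: "('a :: complete_heyting_algebra, 'u) psh_arrow"
  assumes inf: "infinite (UNIV :: 'u set)"
    and f: "f \<in> hom Sh X Z" and g: "g \<in> hom Sh Y Z"
  shows "\<exists>p q. is_pullback Sh f g p q"
proof -
  interpret category Sh by (rule Sh_category)
  note fD = Sh_homD[OF f] and gD = Sh_homD[OF g]
  have pX: "is_presheaf X" and pY: "is_presheaf Y" using fD gD by (simp_all add: is_sheaf_presheaf)
  have "\<exists>pr :: 'u \<times> 'u \<Rightarrow> 'u. inj pr"
    using card_of_Times_same_infinite[OF inf] card_of_ordIso[of "UNIV \<times> UNIV :: ('u \<times> 'u) set" "UNIV :: 'u set"]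
    by (auto simp: bij_betw_def)
  then obtain pr :: "'u \<times> 'u \<Rightarrow> 'u" where pr: "inj pr" by blast
  define un where "un = inv pr"
  have un [simp]: "un (pr z) = z" for z using pr by (simp add: un_def)
  define P where "P = \<lparr>sec = (\<lambda>a. {pr (x, y) | x y. x \<in> sec X a \<and> y \<in> sec Y a \<and> underlying f a x = underlying g a y}),
    res = (\<lambda>a b w. pr (res X a b (fst (un w)), res Y a b (snd (un w))))\<rparr>"
  have secP: "w \<in> sec P a \<longleftrightarrow> (\<exists>x y. w = pr (x, y) \<and> x \<in> sec X a \<and> y \<in> sec Y a \<and>
      underlying f a x = underlying g a y)" for w a
    by (simp add: P_def)
  have pair_secP: "pr (x, y) \<in> sec P a \<longleftrightarrow>
      x \<in> sec X a \<and> y \<in> sec Y a \<and> underlying f a x = underlying g a y" for x y a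
    using pr by (auto simp: secP inj_eq)
  have resP: "res P a b w = pr (res X a b (fst (un w)), res Y a b (snd (un w)))" for a b w
    by (simp add: P_def)
  have preP: "is_presheaf P"
    unfolding is_presheaf_def
    by (auto simp: pair_secP resP res_in res_id res_res pX pY fD(7)[symmetric] gD(7)[symmetric]
        dest!: secP[THEN iffD1])
  have P: "is_sheaf P"
    unfolding is_sheaf_def
  proof (intro conjI preP allI impI)
    fix B w
    assume w: "\<forall>b\<in>B. w b \<in> sec P b"
      and comp: "\<forall>b\<in>B. \<forall>c\<in>B. res P b (inf b c) (w b) = res P c (inf b c) (w c)"
    let ?x = "\<lambda>b. fst (un (w b))" and ?y = "\<lambda>b. snd (un (w b))"
    have xy: "?x b \<in> sec X b" "?y b \<in> sec Y b" "underlying f b (?x b) = underlying g b (?y b)"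
      "w b = pr (?x b, ?y b)" if "b \<in> B" for b
      using w that by (auto simp: secP)
    have eq: "res X b (inf b c) (?x b) = res X c (inf b c) (?x c) \<and>
      res Y b (inf b c) (?y b) = res Y c (inf b c) (?y c)" if "b \<in> B" "c \<in> B" for b c
      using comp[rule_format, OF that] pr by (simp add: resP inj_eq)
    obtain x where x: "x \<in> sec X (Sup B)" "\<And>b. b \<in> B \<Longrightarrow> res X (Sup B) b x = ?x b"
      using sheaf_glue[OF fD(3), of B ?x] xy eq by blast
    obtain y where y: "y \<in> sec Y (Sup B)" "\<And>b. b \<in> B \<Longrightarrow> res Y (Sup B) b y = ?y b"
      using sheaf_glue[OF gD(3), of B ?y] xy eq by blast
    show "\<exists>!z. z \<in> sec P (Sup B) \<and> (\<forall>b\<in>B. res P (Sup B) b z = w b)"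
    proof
      \<comment> \<open>The components are glued separately; they match over \<open>Sup B\<close>
        because their images in \<open>Z\<close> agree on each member of \<open>B\<close>.\<close>
      have "underlying f (Sup B) x = underlying g (Sup B) y"
        by (rule sheaf_eqI[OF fD(4), where B = B])
          (use x y xy fD gD in \<open>auto simp: Sup_upper\<close>)
      then show "pr (x, y) \<in> sec P (Sup B) \<and> (\<forall>b\<in>B. res P (Sup B) b (pr (x, y)) = w b)"
        using x y xy(4) by (auto simp: secP resP)
      fix z assume z: "z \<in> sec P (Sup B) \<and> (\<forall>b\<in>B. res P (Sup B) b z = w b)"
      then obtain x' y' where z': "z = pr (x', y')" "x' \<in> sec X (Sup B)" "y' \<in> sec Y (Sup B)"
        by (auto simp: secP)
      have e: "res X (Sup B) b x' = ?x b \<and> res Y (Sup B) b y' = ?y b" if "b \<in> B" for b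
      proof -
        have "w b = pr (res X (Sup B) b x', res Y (Sup B) b y')"
          using z that by (simp add: z'(1) resP)
        then show ?thesis by simp
      qed
      have "x' = x" by (rule sheaf_eqI[OF fD(3) z'(2) x(1)]) (simp add: e x)
      moreover have "y' = y" by (rule sheaf_eqI[OF gD(3) z'(3) y(1)]) (simp add: e y)
      ultimately show "z = pr (x, y)" using z' by simp
    qed
  qed
  let ?p = "psh_map P X (\<lambda>_ w. fst (un w))" and ?q = "psh_map P Y (\<lambda>_ w. snd (un w))"
  have p: "?p \<in> hom Sh P X" and q: "?q \<in> hom Sh P Y"
    unfolding Sh_hom_iff
    by (auto intro!: psh_map_hom simp: P preP pX pY fD gD secP resP)
  have comm: "Cmp Sh f ?p = Cmp Sh g ?q"
    by (rule Sh_hom_eqI[OF cmp_in_hom[OF p f] cmp_in_hom[OF q g]]) (auto simp: secP)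
  have "\<exists>!h. h \<in> hom Sh W P \<and> Cmp Sh ?p h = u \<and> Cmp Sh ?q h = v"
    if u: "u \<in> hom Sh W X" and v: "v \<in> hom Sh W Y" and uv: "Cmp Sh f u = Cmp Sh g v" for W u v
  proof
    note uD = Sh_homD[OF u] and vD = Sh_homD[OF v]
    let ?h = "psh_map W P (\<lambda>a w. pr (underlying u a w, underlying v a w))"
    have fg: "underlying f a (underlying u a w) = underlying g a (underlying v a w)"
      if "w \<in> sec W a" for a w
      using arg_cong[OF uv, of "\<lambda>z. underlying z a w"] that uD vD by simp
    have h: "?h \<in> hom Sh W P"
      unfolding Sh_hom_iff
      by (auto intro!: psh_map_hom simp: P preP uD vD is_sheaf_presheaf pair_secP resP fg)
    have hsec: "pr (underlying u a w, underlying v a w) \<in> sec P a" if "w \<in> sec W a" for a w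
      using that uD vD fg by (auto simp: pair_secP)
    have "Cmp Sh ?p ?h = u"
      by (rule Sh_hom_eqI[OF cmp_in_hom[OF h p] u]) (simp add: hsec)
    moreover have "Cmp Sh ?q ?h = v"
      by (rule Sh_hom_eqI[OF cmp_in_hom[OF h q] v]) (simp add: hsec)
    ultimately show "?h \<in> hom Sh W P \<and> Cmp Sh ?p ?h = u \<and> Cmp Sh ?q ?h = v" using h by simp
    fix k assume k: "k \<in> hom Sh W P \<and> Cmp Sh ?p k = u \<and> Cmp Sh ?q k = v"
    then have kh: "k \<in> hom Sh W P" by simp
    note kD = Sh_homD[OF kh]
    show "k = ?h"
    proof (rule Sh_hom_eqI[OF kh h])
      fix a w assume w: "w \<in> sec W a"
      have "underlying u a w = fst (un (underlying k a w))" "underlying v a w = snd (un (underlying k a w))"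
        using k kD w by auto
      then show "underlying k a w = underlying ?h a w"
        using kD(6)[OF w] w by (auto simp: secP)
    qed
  qed
  then have "is_pullback Sh f g ?p ?q"
    using f g p q comm fD gD by (auto simp: is_pullback_def hom_def)
  then show ?thesis by blast
qed

section \<open>Prime elements of a well-founded basis\<close>

text \<open>Meet with \<open>a\<close> has the right adjoint \<open>heyting_imp a\<close>, hence it
  preserves joins.\<close>

lemma inf_Sup_heyting:
  fixes a :: "'a :: complete_heyting_algebra"
  shows "inf a (Sup B) = (SUP b\<in>B. inf a b)"
proof (rule antisym)
  have "Sup B \<le> heyting_imp a (SUP b\<in>B. inf a b)"
    by (rule Sup_least) (auto simp: le_heyting_imp_iff inf_commute intro!: SUP_upper2)
  then show "inf a (Sup B) \<le> (SUP b\<in>B. inf a b)"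
    by (simp add: le_heyting_imp_iff inf_commute)
  show "(SUP b\<in>B. inf a b) \<le> inf a (Sup B)"
    by (auto intro!: SUP_least intro: le_infI2 Sup_upper)
qed

locale wf_basis =
  fixes K :: "'a :: complete_heyting_algebra set"
  assumes wf_basis: "well_founded_basis K"
begin

text \<open>These elements still form a basis, and they are completely join-prime. Hence a sheaf is determined by
  its restriction to them, on which it is just a presheaf.\<close>

definition primes :: "'a set" where
  "primes = {k \<in> K. pred_join K k \<noteq> k}"

abbreviation below :: "'a \<Rightarrow> 'a set" where
  "below a \<equiv> {k \<in> primes. k \<le> a}"

lemma pred_join_le: "pred_join K a \<le> a"
  unfolding pred_join_def by (rule Sup_least) auto

lemma pred_join_mono: "a \<le> b \<Longrightarrow> pred_join K a \<le> pred_join K b"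
  unfolding pred_join_def by (rule Sup_subset_mono) auto

lemma basis: "a = Sup {k \<in> K. k \<le> a}"
  using wf_basis unfolding well_founded_basis_def by blast

lemma wf_less_basis: "wf {(j, k). j \<in> K \<and> k \<in> K \<and> j < k}"
  using wf_basis by (auto simp: wf_iff_no_infinite_down_chain well_founded_basis_def)

text \<open>If \<open>j\<close> were equal to \<open>k\<close>, then \<open>k\<close> would lie
  below its own predecessor join, against primality. This is what makes well-founded induction on
  \<open>k\<close> reach the sections over \<open>pred_join K k\<close>.\<close>

lemma prime_le_pred_join_iff:
  assumes k: "k \<in> primes" and j: "j \<in> primes"
  shows "j \<le> pred_join K k \<longleftrightarrow> j < k"
proof
  show "j < k" if "j \<le> pred_join K k"
    using that pred_join_le[of k] k by (auto simp: primes_def)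
  show "j \<le> pred_join K k" if "j < k"
    unfolding pred_join_def by (rule Sup_upper) (use that j in \<open>auto simp: primes_def\<close>)
qed

lemma prime_le_Sup:
  assumes k: "k \<in> primes" and le: "k \<le> Sup B"
  shows "\<exists>b\<in>B. k \<le> b"
proof (rule ccontr)
  assume contra: "\<not> (\<exists>b\<in>B. k \<le> b)"
  have "inf k b \<le> pred_join K k" if b: "b \<in> B" for b
  proof -
    \<comment> \<open>A basis element below both \<open>k\<close> and \<open>b\<close> differs from
      \<open>k\<close>, since \<open>k\<close> is not below \<open>b\<close>.\<close>
    have "{j \<in> K. j \<le> inf k b} \<subseteq> {j \<in> K. j < k}"
      using b contra by (auto simp: order_less_le)
    then show ?thesis
      using basis[of "inf k b"] Sup_subset_mono unfolding pred_join_def by metis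
  qed
  then have "inf k (Sup B) \<le> pred_join K k"
    unfolding inf_Sup_heyting by (auto intro: SUP_least)
  then have "pred_join K k = k"
    using le pred_join_le[of k] by (simp add: inf_absorb1 order_antisym)
  then show False using k by (simp add: primes_def)
qed

text \<open>By well-founded induction, a basis element that is not prime is the join of the basis
  elements strictly below it, and these are already joins of primes. As \<open>K\<close> is a basis,
  the claim passes from \<open>K\<close> to the whole algebra.\<close>

lemma prime_basis: "Sup (below a) = a"
proof -
  have K: "Sup (below k) = k" if "k \<in> K" for k
    using that
  proof (induction k rule: wf_induct_rule[OF wf_less_basis])
    case (1 k)
    show ?case
    proof (rule antisym)
      show "Sup (below k) \<le> k" by (rule Sup_least) auto
      show "k \<le> Sup (below k)"
      proof (cases "k \<in> primes")
        case True
        then show ?thesis by (auto intro: Sup_upper)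
      next
        case False
        have "j \<le> Sup (below k)" if j: "j \<in> K" "j < k" for j
        proof -
          have "Sup (below j) \<le> Sup (below k)"
            by (rule Sup_subset_mono) (use j in auto)
          then show ?thesis using 1 j by auto
        qed
        then have "pred_join K k \<le> Sup (below k)"
          unfolding pred_join_def by (auto intro: Sup_least)
        then show ?thesis using False 1 by (simp add: primes_def)
      qed
    qed
  qed
  show ?thesis
  proof (rule antisym)
    show "Sup (below a) \<le> a" by (rule Sup_least) auto
    have "k \<le> Sup (below a)" if "k \<in> K" "k \<le> a" for k
    proof -
      have "Sup (below k) \<le> Sup (below a)"
        by (rule Sup_subset_mono) (use that in auto)
      then show ?thesis using K[OF that(1)] by simp
    qed
    then have "Sup {k \<in> K. k \<le> a} \<le> Sup (below a)" by (auto intro: Sup_least)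
    then show "a \<le> Sup (below a)" using basis[of a] by simp
  qed
qed

section \<open>Sheaf conditions tested on primes\<close>

lemma sheaf_basis_eqI:
  assumes X: "is_sheaf X" and xy: "x \<in> sec X a" "y \<in> sec X a"
    and eq: "\<And>k. k \<in> primes \<Longrightarrow> k \<le> a \<Longrightarrow> res X a k x = res X a k y"
  shows "x = y"
  by (rule sheaf_eqI[OF X, of x "below a"]) (use xy eq in \<open>auto simp: prime_basis\<close>)

text \<open>Compatibility is demanded only along the order, because the meet of two primes need not
  be prime. Agreement on \<open>inf b c\<close> is then tested on the primes below it.\<close>

lemma sheaf_basis_glue:
  assumes X: "is_sheaf X" and z: "\<And>k. k \<in> primes \<Longrightarrow> k \<le> a \<Longrightarrow> z k \<in> sec X k"
    and comp: "\<And>j k. j \<in> primes \<Longrightarrow> k \<in> primes \<Longrightarrow> j \<le> k \<Longrightarrow> k \<le> a \<Longrightarrow> res X k j (z k) = z j"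
  shows "\<exists>x\<in>sec X a. \<forall>k\<in>below a. res X a k x = z k"
proof -
  note pX = is_sheaf_presheaf[OF X]
  have "res X b (inf b c) (z b) = res X c (inf b c) (z c)" if b: "b \<in> below a" and c: "c \<in> below a" for b c
  proof (rule sheaf_basis_eqI[OF X])
    show "res X b (inf b c) (z b) \<in> sec X (inf b c)" "res X c (inf b c) (z c) \<in> sec X (inf b c)"
      using z b c by (auto intro!: res_in pX)
    fix k assume "k \<in> primes" "k \<le> inf b c"
    then show "res X (inf b c) k (res X b (inf b c) (z b)) = res X (inf b c) k (res X c (inf b c) (z c))"
      using z b c comp by (simp add: res_res pX)
  qed
  then show ?thesis using sheaf_glue[OF X, of "below a" z] z by (auto simp: prime_basis)
qed

text \<open>Here join-primality enters: whatever the cover \<open>B\<close>, each prime below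
  \<open>Sup B\<close> already lies below a member of \<open>B\<close>, so a family on
  \<open>B\<close> induces one on primes.\<close>

lemma is_sheaf_basisI:
  assumes X: "is_presheaf X"
    and sep: "\<And>a x y. x \<in> sec X a \<Longrightarrow> y \<in> sec X a \<Longrightarrow>
      (\<And>k. k \<in> primes \<Longrightarrow> k \<le> a \<Longrightarrow> res X a k x = res X a k y) \<Longrightarrow> x = y"
    and glue: "\<And>a z. (\<And>k. k \<in> primes \<Longrightarrow> k \<le> a \<Longrightarrow> z k \<in> sec X k) \<Longrightarrow>
      (\<And>j k. j \<in> primes \<Longrightarrow> k \<in> primes \<Longrightarrow> j \<le> k \<Longrightarrow> k \<le> a \<Longrightarrow> res X k j (z k) = z j) \<Longrightarrow>
      \<exists>x\<in>sec X a. \<forall>k\<in>below a. res X a k x = z k"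
  shows "is_sheaf X"
  unfolding is_sheaf_def
proof (intro conjI X allI impI)
  fix B x
  assume x: "\<forall>b\<in>B. x b \<in> sec X b"
    and comp: "\<forall>b\<in>B. \<forall>c\<in>B. res X b (inf b c) (x b) = res X c (inf b c) (x c)"
  have agree: "res X b k (x b) = res X c k (x c)" if "b \<in> B" "c \<in> B" "k \<le> b" "k \<le> c" for b c k
  proof -
    have "res X (inf b c) k (res X b (inf b c) (x b)) = res X (inf b c) k (res X c (inf b c) (x c))"
      using comp[rule_format, OF that(1,2)] by simp
    then show ?thesis using that x by (simp add: res_res X)
  qed
  have "\<forall>k\<in>below (Sup B). \<exists>b\<in>B. k \<le> b" using prime_le_Sup by blast
  \<comment> \<open>Any member of \<open>B\<close> above \<open>k\<close> will do: by
    \<open>agree\<close> the induced section over \<open>k\<close> does not depend on it.\<close>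
  then obtain \<beta> where \<beta>: "\<And>k. k \<in> below (Sup B) \<Longrightarrow> \<beta> k \<in> B \<and> k \<le> \<beta> k" by metis
  define z where "z k = res X (\<beta> k) k (x (\<beta> k))" for k
  have z: "res X b k (x b) = z k" if "b \<in> B" "k \<in> primes" "k \<le> b" for b k
  proof -
    have "k \<in> below (Sup B)" using that by (auto intro: order_trans Sup_upper)
    then show ?thesis using that \<beta> agree unfolding z_def by blast
  qed
  have "\<exists>y\<in>sec X (Sup B). \<forall>k\<in>below (Sup B). res X (Sup B) k y = z k"
  proof (rule glue)
    show "z k \<in> sec X k" if "k \<in> primes" "k \<le> Sup B" for k
      unfolding z_def using \<beta>[of k] that x by (auto intro!: res_in X)
    show "res X k j (z k) = z j" if "j \<in> primes" "k \<in> primes" "j \<le> k" "k \<le> Sup B" for j k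
    proof -
      have k: "\<beta> k \<in> B" "k \<le> \<beta> k" using \<beta> that by auto
      then have "res X k j (z k) = res X (\<beta> k) j (x (\<beta> k))"
        unfolding z_def using that x by (simp add: res_res X)
      also have "\<dots> = z j" by (rule z) (use k that in auto)
      finally show ?thesis .
    qed
  qed
  then obtain y where y: "y \<in> sec X (Sup B)" "\<And>k. k \<in> below (Sup B) \<Longrightarrow> res X (Sup B) k y = z k"
    by blast
  show "\<exists>!y. y \<in> sec X (Sup B) \<and> (\<forall>b\<in>B. res X (Sup B) b y = x b)"
  proof
    have "res X (Sup B) b y = x b" if b: "b \<in> B" for b
    proof (rule sep)
      show "res X (Sup B) b y \<in> sec X b" by (rule res_in[OF X Sup_upper[OF b] y(1)])
      show "x b \<in> sec X b" using x b by blast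
      fix k assume k: "k \<in> primes" "k \<le> b"
      then have "k \<le> Sup B" using b by (auto intro: order_trans Sup_upper)
      then show "res X b k (res X (Sup B) b y) = res X b k (x b)"
        using k b y z by (simp add: res_res X Sup_upper)
    qed
    then show "y \<in> sec X (Sup B) \<and> (\<forall>b\<in>B. res X (Sup B) b y = x b)" using y by blast
    fix y' assume y': "y' \<in> sec X (Sup B) \<and> (\<forall>b\<in>B. res X (Sup B) b y' = x b)"
    show "y' = y"
    proof (rule sep)
      fix k assume k: "k \<in> primes" "k \<le> Sup B"
      then have b: "\<beta> k \<in> B" "k \<le> \<beta> k" using \<beta> by auto
      have "res X (Sup B) k y' = res X (\<beta> k) k (res X (Sup B) (\<beta> k) y')"
        using res_res[OF X b(2) Sup_upper[OF b(1)], of y'] y' by simp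
      then show "res X (Sup B) k y' = res X (Sup B) k y"
        using b k y y' by (simp add: z_def)
    qed (use y y' in blast)+
  qed
qed

text \<open>The section over \<open>a\<close> is glued from the solutions over primes. Their
  compatibility comes from uniqueness: by \<open>loc\<close>, the restriction of a solution to a
  smaller prime is again a solution, hence the solution there.\<close>

lemma unique_section:
  assumes X: "is_sheaf X"
    and loc: "\<And>b x. b \<le> a \<Longrightarrow> x \<in> sec X b \<Longrightarrow> Q b x \<longleftrightarrow> (\<forall>k\<in>below b. Q k (res X b k x))"
    and ex1: "\<And>k. k \<in> primes \<Longrightarrow> k \<le> a \<Longrightarrow> \<exists>!x. x \<in> sec X k \<and> Q k x"
  shows "\<exists>!x. x \<in> sec X a \<and> Q a x"
proof -
  note pX = is_sheaf_presheaf[OF X]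
  define z where "z k = (THE x. x \<in> sec X k \<and> Q k x)" for k
  have z: "z k \<in> sec X k" "Q k (z k)" if "k \<in> primes" "k \<le> a" for k
    using theI'[OF ex1[OF that]] by (simp_all add: z_def)
  have z_eq: "x = z k" if "k \<in> primes" "k \<le> a" "x \<in> sec X k" "Q k x" for k x
    using ex1[OF that(1,2)] z[OF that(1,2)] that(3,4) by blast
  have comp: "res X k j (z k) = z j" if "j \<in> primes" "k \<in> primes" "j \<le> k" "k \<le> a" for j k
  proof (rule z_eq)
    show "res X k j (z k) \<in> sec X j" using that z by (auto intro: res_in pX)
    show "Q j (res X k j (z k))" using loc[of k "z k"] z that by blast
  qed (use that in auto)
  obtain x where x: "x \<in> sec X a" "\<forall>k\<in>below a. res X a k x = z k"
    using sheaf_basis_glue[OF X, of a z] z comp by blast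
  show ?thesis
  proof
    show "x \<in> sec X a \<and> Q a x" using x z loc[of a x] by auto
    fix y assume y: "y \<in> sec X a \<and> Q a y"
    show "y = x"
    proof (rule sheaf_basis_eqI[OF X])
      fix k assume k: "k \<in> primes" "k \<le> a"
      have "res X a k y = z k"
        by (rule z_eq[OF k]) (use y k loc[of a y] in \<open>auto intro: res_in pX\<close>)
      then show "res X a k y = res X a k x" using x k by simp
    qed (use x y in auto)
  qed
qed

text \<open>\<open>R\<close> serves as the graph of the map. \<open>unique_section\<close> provides
  its values, and locality makes \<open>R\<close> stable under restriction, so that the values are
  natural. Mediating maps of the associated sheaf and of limit cones, and the fixed points, are all
  obtained from this lemma.\<close>

lemma hom_by_local_relation:
  assumes M: "is_sheaf M" and X: "is_sheaf X"
    and loc: "\<And>a m x. m \<in> sec M a \<Longrightarrow> x \<in> sec X a \<Longrightarrow>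
      R a m x \<longleftrightarrow> (\<forall>k\<in>below a. R k (res M a k m) (res X a k x))"
    and ex1: "\<And>k m. k \<in> primes \<Longrightarrow> m \<in> sec M k \<Longrightarrow> \<exists>!x. x \<in> sec X k \<and> R k m x"
  shows "\<exists>!h. h \<in> hom Sh M X \<and> (\<forall>a. \<forall>m\<in>sec M a. R a m (underlying h a m))"
proof -
  note pM = is_sheaf_presheaf[OF M] and pX = is_sheaf_presheaf[OF X]
  have all_ex1: "\<exists>!x. x \<in> sec X a \<and> R a m x" if m: "m \<in> sec M a" for a m
  proof -
    have "\<exists>!x. x \<in> sec X a \<and> R a (res M a a m) x"
    proof (rule unique_section[OF X, where Q = "\<lambda>b. R b (res M a b m)"])
      fix b x assume b: "b \<le> a" and x: "x \<in> sec X b"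
      show "R b (res M a b m) x \<longleftrightarrow> (\<forall>k\<in>below b. R k (res M a k m) (res X b k x))"
        using loc[OF res_in[OF pM b m] x] by (simp add: res_res[OF pM _ b m])
    next
      fix k assume "k \<in> primes" "k \<le> a"
      then show "\<exists>!x. x \<in> sec X k \<and> R k (res M a k m) x" using ex1 res_in[OF pM _ m] by blast
    qed
    then show ?thesis by (simp add: res_id pM m)
  qed
  define \<phi> where "\<phi> a m = (THE x. x \<in> sec X a \<and> R a m x)" for a m
  have \<phi>: "\<phi> a m \<in> sec X a" "R a m (\<phi> a m)" if "m \<in> sec M a" for a m
    using theI'[OF all_ex1[OF that]] by (simp_all add: \<phi>_def)
  have \<phi>_eq: "x = \<phi> a m" if "m \<in> sec M a" "x \<in> sec X a" "R a m x" for a m x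
    using all_ex1[OF that(1)] \<phi>[OF that(1)] that(2,3) by blast
  have stable: "R b (res M a b m) (res X a b x)"
    if b: "b \<le> a" and m: "m \<in> sec M a" and x: "x \<in> sec X a" and R: "R a m x" for a b m x
  proof -
    have "R k (res M a k m) (res X a k x)" if "k \<in> below b" for k
      using loc[OF m x] R that b by (auto intro: order_trans)
    then show ?thesis
      using loc[OF res_in[OF pM b m] res_in[OF pX b x]] by (simp add: res_res pM pX b m x)
  qed
  let ?h = "psh_map M X \<phi>"
  have h: "?h \<in> hom Sh M X"
    unfolding Sh_hom_iff
    by (auto intro!: psh_map_hom \<phi>_eq stable simp: M X pM pX \<phi> res_in)
  show ?thesis
  proof
    show "?h \<in> hom Sh M X \<and> (\<forall>a. \<forall>m\<in>sec M a. R a m (underlying ?h a m))"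
      using h \<phi> by simp
    fix g assume g: "g \<in> hom Sh M X \<and> (\<forall>a. \<forall>m\<in>sec M a. R a m (underlying g a m))"
    show "g = ?h"
      by (rule Sh_hom_eqI[OF _ h]) (use g Sh_homD(6)[of g M X] \<phi>_eq in auto)
  qed
qed

section \<open>The associated sheaf\<close>

text \<open>Over primes all covers are trivial, so the associated sheaf does not change the sections there.\<close>

lemma sheafification_exists:
  fixes Q :: "('a, 'u) presheaf"
  assumes d: "inj (d :: ('a \<Rightarrow> 'u) \<Rightarrow> 'u)" and Q: "is_presheaf Q"
  shows "\<exists>\<eta>. is_sheafification Q \<eta> \<and>
    (\<forall>k\<in>primes. bij_betw (underlying \<eta> k) (sec Q k) (sec (target \<eta>) k))"
proof -
  \<comment> \<open>The associated sheaf at \<open>a\<close> is the limit of \<open>Q\<close> over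
    the primes below \<open>a\<close>. Extensional families represent each point of this limit once,
    and \<open>d\<close> codes them as elements of the universe.\<close>
  define families where "families a = {x \<in> Pi\<^sub>E (below a) (sec Q).
    \<forall>k\<in>below a. \<forall>j\<in>below k. res Q k j (x k) = x j}" for a
  define u where "u = inv d"
  have u [simp]: "u (d x) = x" for x using d by (simp add: u_def)
  define F where "F = \<lparr>sec = (\<lambda>a. d ` families a), res = (\<lambda>_ b w. d (restrict (u w) (below b)))\<rparr>"
  have secF: "sec F a = d ` families a" for a by (simp add: F_def)
  have resF: "res F a b w = d (restrict (u w) (below b))" for a b w by (simp add: F_def)
  have d_eq: "d x = d y \<longleftrightarrow> x = y" for x y using d by (simp add: inj_eq)
  have d_secF: "d x \<in> sec F a \<longleftrightarrow> x \<in> families a" for x a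
    using d by (auto simp: secF inj_eq)
  have fam_sec: "x k \<in> sec Q k" if "x \<in> families a" "k \<in> primes" "k \<le> a" for x a k
    using that by (auto simp: families_def)
  have fam_comp: "res Q k j (x k) = x j" if "x \<in> families a" "k \<in> primes" "k \<le> a" "j \<in> primes" "j \<le> k" for x a j k
    using that by (auto simp: families_def)
  have fam_restrict: "restrict x (below b) \<in> families b" if "x \<in> families a" "b \<le> a" for x a b
  proof -
    have "k \<le> a" if "k \<le> b" for k using that \<open>b \<le> a\<close> by simp
    then show ?thesis
      using fam_sec[OF that(1)] fam_comp[OF that(1)] by (auto simp: families_def intro: order_trans)
  qed
  have fam_id: "restrict x (below a) = x" if "x \<in> families a" for x a
    using that by (auto simp: families_def intro: PiE_restrict)
  have preF: "is_presheaf F"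
    unfolding is_presheaf_def
  proof (intro conjI allI impI ballI funcsetI)
    show "res F a b w \<in> sec F b" if "b \<le> a" "w \<in> sec F a" for a b w
      using that fam_restrict by (auto simp: secF resF)
    show "res F a a w = w" if "w \<in> sec F a" for a w
      using that fam_id by (auto simp: secF resF)
    show "res F b c (res F a b w) = res F a c w" if "c \<le> b" "b \<le> a" "w \<in> sec F a" for a b c w
    proof -
      have "below b \<inter> below c = below c" using that by auto
      then show ?thesis by (simp add: resF Int_absorb1 restrict_restrict)
    qed
  qed
  have F: "is_sheaf F"
  proof (rule is_sheaf_basisI[OF preF])
    fix a w w'
    assume w: "w \<in> sec F a" "w' \<in> sec F a"
      and eq: "\<And>k. k \<in> primes \<Longrightarrow> k \<le> a \<Longrightarrow> res F a k w = res F a k w'"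
    obtain x x' where x: "x \<in> families a" "w = d x" "x' \<in> families a" "w' = d x'"
      using w by (auto simp: secF)
    have "x k = x' k" if k: "k \<in> below a" for k
    proof -
      have "restrict x (below k) = restrict x' (below k)"
        using eq[of k] k by (simp add: x resF d_eq)
      from fun_cong[OF this, of k] show ?thesis using k by simp
    qed
    then have "restrict x (below a) = restrict x' (below a)" by (intro restrict_ext)
    then show "w = w'" using x fam_id by metis
  next
    fix a z
    assume z: "\<And>k. k \<in> primes \<Longrightarrow> k \<le> a \<Longrightarrow> z k \<in> sec F k"
      and comp: "\<And>j k. j \<in> primes \<Longrightarrow> k \<in> primes \<Longrightarrow> j \<le> k \<Longrightarrow> k \<le> a \<Longrightarrow> res F k j (z k) = z j"
    have z': "u (z k) \<in> families k" "d (u (z k)) = z k" if "k \<in> primes" "k \<le> a" for k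
      using z[OF that] by (auto simp: secF)
    have comp': "u (z k) j = u (z j) j" if "j \<in> primes" "k \<in> primes" "j \<le> k" "k \<le> a" for j k
    proof -
      have "u (z j) = restrict (u (z k)) (below j)"
        using arg_cong[OF comp[OF that], of u] by (simp add: resF)
      then show ?thesis using that by simp
    qed
    let ?x = "\<lambda>k\<in>below a. u (z k) k"
    have x: "?x \<in> families a"
      unfolding families_def
    proof (intro CollectI conjI ballI PiE_I)
      show "?x k \<in> sec Q k" if "k \<in> below a" for k using that fam_sec[OF z'(1)] by auto
      show "res Q k j (?x k) = ?x j" if "k \<in> below a" "j \<in> below k" for j k
        using that fam_comp[OF z'(1), of k k j] comp'[of j k] by (auto intro: order_trans)
    qed auto
    have "res F a k (d ?x) = z k" if k: "k \<in> below a" for k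
    proof -
      have "restrict ?x (below k) = restrict (u (z k)) (below k)"
      proof (rule restrict_ext)
        fix j assume j: "j \<in> below k"
        then show "?x j = u (z k) j" using k comp'[of j k] by (auto intro: order_trans)
      qed
      then show ?thesis using k z'[of k] fam_id[of "u (z k)" k] by (simp add: resF)
    qed
    then show "\<exists>w\<in>sec F a. \<forall>k\<in>below a. res F a k w = z k"
      using x by (auto simp: secF)
  qed
  define \<eta> where "\<eta> = psh_map Q F (\<lambda>a q. d (\<lambda>k\<in>below a. res Q a k q))"
  have fam_unit: "(\<lambda>k\<in>below a. res Q a k q) \<in> families a" if "q \<in> sec Q a" for a q
    unfolding families_def
    by (auto simp: res_in[OF Q _ that] res_res[OF Q _ _ that] intro: order_trans)
  have \<eta>: "\<eta> \<in> hom PSh Q F"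
    unfolding \<eta>_def
  proof (rule psh_map_hom[OF Q preF])
    fix a b q assume b: "b \<le> a" and q: "q \<in> sec Q a"
    have "k \<le> a" if "k \<le> b" for k using that b by simp
    then show "res F a b (d (\<lambda>k\<in>below a. res Q a k q)) = d (\<lambda>k\<in>below b. res Q b k (res Q a b q))"
      by (auto simp: resF d_eq restrict_def fun_eq_iff res_res[OF Q _ b q])
  qed (simp add: d_secF fam_unit)
  \<comment> \<open>A compatible family on \<open>below k\<close> is determined by its entry at
    \<open>k\<close>, the largest prime there. Both surjectivity over primes and the universal
    property rest on this.\<close>
  have \<eta>_prime: "res F a k (d x) = underlying \<eta> k (x k)" if "x \<in> families a" "k \<in> primes" "k \<le> a" for a k x
  proof -
    have "restrict x (below k) = (\<lambda>j\<in>below k. res Q k j (x k))"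
      by (rule restrict_ext) (use that fam_comp[OF that] in auto)
    then show ?thesis using fam_sec[OF that] by (simp add: \<eta>_def resF)
  qed
  have target: "target \<eta> = F" by (simp add: \<eta>_def)
  have univ: "\<exists>!h. h \<in> hom Sh F G \<and> Cmp PSh h \<eta> = g" if G: "is_sheaf G" and g: "g \<in> hom PSh Q G" for G g
  proof -
    note gD = PSh_homD[OF g] and pG = is_sheaf_presheaf[OF G]
    \<comment> \<open>The mediating map has to send a family to the section of \<open>G\<close>
      glued from the images of its entries under \<open>g\<close>.\<close>
    let ?R = "\<lambda>a w y. \<forall>k\<in>below a. res G a k y = underlying g k (u w k)"
    have ex: "\<exists>!h. h \<in> hom Sh F G \<and> (\<forall>a. \<forall>w\<in>sec F a. ?R a w (underlying h a w))"
    proof (rule hom_by_local_relation[OF F G])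
      fix a w y assume w: "w \<in> sec F a" and y: "y \<in> sec G a"
      show "?R a w y \<longleftrightarrow> (\<forall>k\<in>below a. ?R k (res F a k w) (res G a k y))"
      proof
        assume R: "?R a w y"
        show "\<forall>k\<in>below a. ?R k (res F a k w) (res G a k y)"
        proof (intro ballI)
          fix k j assume k: "k \<in> below a" and j: "j \<in> below k"
          then have "res G k j (res G a k y) = res G a j y" and "j \<in> below a"
            by (auto simp only: mem_Collect_eq intro: order_trans res_res[OF pG _ _ y])
          then show "res G k j (res G a k y) = underlying g j (u (res F a k w) j)"
            using R j by (simp add: resF)
        qed
      next
        assume R: "\<forall>k\<in>below a. ?R k (res F a k w) (res G a k y)"
        show "?R a w y"
        proof
          fix k assume k: "k \<in> below a"
          then have "res G k k (res G a k y) = underlying g k (u (res F a k w) k)" using R by auto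
          then show "res G a k y = underlying g k (u w k)"
            using k by (simp add: resF res_res[OF pG _ _ y])
        qed
      qed
    next
      fix k w assume k: "k \<in> primes" and w: "w \<in> sec F k"
      then obtain x where x: "x \<in> families k" "w = d x" by (auto simp: secF)
      show "\<exists>!y. y \<in> sec G k \<and> ?R k w y"
      proof
        show "underlying g k (x k) \<in> sec G k \<and> ?R k w (underlying g k (x k))"
          using k x gD fam_sec[OF x(1) k] fam_comp[OF x(1) k] by auto
        show "y = underlying g k (x k)" if "y \<in> sec G k \<and> ?R k w y" for y
          using that k x res_id[OF pG, of y k] by auto
      qed
    qed
    \<comment> \<open>Factoring \<open>g\<close> through \<open>\<eta>\<close> is the same as
      satisfying \<open>?R\<close>: \<open>\<eta>_prime\<close> reads off the entries in one
      direction, and separation over primes gives the other.\<close>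
    have "Cmp PSh h \<eta> = g \<longleftrightarrow> (\<forall>a. \<forall>w\<in>sec F a. ?R a w (underlying h a w))" if h: "h \<in> hom Sh F G" for h
    proof
      note hD = Sh_homD[OF h]
      assume eq: "Cmp PSh h \<eta> = g"
      show "\<forall>a. \<forall>w\<in>sec F a. ?R a w (underlying h a w)"
      proof (intro allI ballI)
        fix a w k assume w: "w \<in> sec F a" and k: "k \<in> below a"
        obtain x where x: "x \<in> families a" "w = d x" using w by (auto simp: secF)
        have "res G a k (underlying h a w) = underlying h k (underlying \<eta> k (x k))"
          using hD(7)[OF _ w, of k] \<eta>_prime[OF x(1)] k x(2) by simp
        also have "\<dots> = underlying (Cmp PSh h \<eta>) k (x k)"
          using fam_sec[OF x(1)] k PSh_homD(1)[OF \<eta>] by simp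
        finally show "res G a k (underlying h a w) = underlying g k (u w k)" using eq x by simp
      qed
    next
      note hD = Sh_homD[OF h]
      assume R: "\<forall>a. \<forall>w\<in>sec F a. ?R a w (underlying h a w)"
      interpret P: category PSh by (rule PSh_category)
      show "Cmp PSh h \<eta> = g"
      proof (rule PSh_hom_eqI[OF P.cmp_in_hom[OF \<eta> hD(5)] g])
        fix a q assume q: "q \<in> sec Q a"
        note \<eta>q = PSh_homD(5)[OF \<eta> q]
        have "underlying h a (underlying \<eta> a q) = underlying g a q"
        proof (rule sheaf_basis_eqI[OF G hD(6)[OF \<eta>q] gD(5)[OF q]])
          fix k assume k: "k \<in> primes" "k \<le> a"
          then have "res G a k (underlying h a (underlying \<eta> a q)) = underlying g k (u (underlying \<eta> a q) k)"
            using R \<eta>q by blast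
          then show "res G a k (underlying h a (underlying \<eta> a q)) = res G a k (underlying g a q)"
            using k q by (simp add: gD(6)) (simp add: \<eta>_def)
        qed
        then show "underlying (Cmp PSh h \<eta>) a q = underlying g a q"
          using q PSh_homD(1)[OF \<eta>] by simp
      qed
    qed
    then have "h \<in> hom Sh F G \<and> Cmp PSh h \<eta> = g \<longleftrightarrow>
        h \<in> hom Sh F G \<and> (\<forall>a. \<forall>w\<in>sec F a. ?R a w (underlying h a w))" for h
      by blast
    then show ?thesis using ex by (simp only:)
  qed
  have "bij_betw (underlying \<eta> k) (sec Q k) (sec F k)" if k: "k \<in> primes" for k
    unfolding bij_betw_def
  proof
    show "inj_on (underlying \<eta> k) (sec Q k)"
    proof (rule inj_onI)
      fix q q' assume q: "q \<in> sec Q k" "q' \<in> sec Q k" and eq: "underlying \<eta> k q = underlying \<eta> k q'"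
      then have "(\<lambda>j\<in>below k. res Q k j q) = (\<lambda>j\<in>below k. res Q k j q')"
        by (simp add: \<eta>_def d_eq)
      then have "(\<lambda>j\<in>below k. res Q k j q) k = (\<lambda>j\<in>below k. res Q k j q') k" by (rule fun_cong)
      then show "q = q'" using k q by (simp add: res_id Q)
    qed
    show "underlying \<eta> k ` sec Q k = sec F k"
    proof
      show "underlying \<eta> k ` sec Q k \<subseteq> sec F k" using PSh_homD(5)[OF \<eta>] by blast
      show "sec F k \<subseteq> underlying \<eta> k ` sec Q k"
      proof
        fix w assume w: "w \<in> sec F k"
        then obtain x where x: "x \<in> families k" "w = d x" by (auto simp: secF)
        then show "w \<in> underlying \<eta> k ` sec Q k"
          using \<eta>_prime[OF x(1) k] res_id[OF preF w] fam_sec[OF x(1) k]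
          by (auto intro!: image_eqI[of _ _ "x k"])
      qed
    qed
  qed
  moreover have "is_sheafification Q \<eta>"
    using F \<eta> univ unfolding is_sheafification_def target by blast
  ultimately show ?thesis using target by blast
qed

end

section \<open>The sheafification functor\<close>

locale wf_basis_universe = wf_basis K
  for K :: "'a :: complete_heyting_algebra set" +
  fixes d :: "('a \<Rightarrow> 'u) \<Rightarrow> 'u"
  assumes inj_d: "inj d"
    and infinite_universe: "infinite (UNIV :: 'u set)"
begin

lemma sheafification_unit:
  fixes Q :: "('a, 'u) presheaf"
  assumes "is_presheaf Q"
  shows "is_sheafification Q (sheafify_unit Q)"
  unfolding sheafify_unit_def by (rule someI_ex) (use sheafification_exists[OF inj_d assms] in blast)

lemma sheafification_ex1:
  assumes "is_sheafification Q \<eta>" "is_sheaf G" "g \<in> hom PSh Q G"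
  shows "\<exists>!h. h \<in> hom Sh (target \<eta>) G \<and> Cmp PSh h \<eta> = g"
  using assms unfolding is_sheafification_def by blast

text \<open>The explicit sheafification \<open>\<theta>\<close> is bijective over \<open>k\<close>.
  It is the composite of \<open>\<eta>\<close> with the comparison map \<open>h\<close>, so
  \<open>\<eta>\<close> is injective there; surjectivity follows because \<open>h\<close> has the
  left inverse \<open>g\<close>, which takes \<open>\<theta>\<close> back to
  \<open>\<eta>\<close>.\<close>

lemma sheafification_bij:
  fixes Q :: "('a, 'u) presheaf"
  assumes \<eta>: "is_sheafification Q \<eta>" and k: "k \<in> primes"
  shows "bij_betw (underlying \<eta> k) (sec Q k) (sec (target \<eta>) k)"
proof -
  interpret S: category "Sh :: (('a, 'u) presheaf, ('a, 'u) psh_arrow) cat" by (rule Sh_category)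
  interpret P: category "PSh :: (('a, 'u) presheaf, ('a, 'u) psh_arrow) cat" by (rule PSh_category)
  have \<eta>_hom: "\<eta> \<in> hom PSh Q (target \<eta>)" and F: "is_sheaf (target \<eta>)"
    using \<eta> by (auto simp: is_sheafification_def)
  note \<eta>D = PSh_homD[OF \<eta>_hom]
  obtain \<theta> where \<theta>: "is_sheafification Q \<theta>"
    "bij_betw (underlying \<theta> k) (sec Q k) (sec (target \<theta>) k)"
    using sheafification_exists[OF inj_d \<eta>D(3)] k by blast
  have \<theta>_hom: "\<theta> \<in> hom PSh Q (target \<theta>)" and F': "is_sheaf (target \<theta>)"
    using \<theta> by (auto simp: is_sheafification_def)
  obtain h where h: "h \<in> hom Sh (target \<eta>) (target \<theta>)" "Cmp PSh h \<eta> = \<theta>"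
    using sheafification_ex1[OF \<eta> F' \<theta>_hom] by blast
  obtain g where g: "g \<in> hom Sh (target \<theta>) (target \<eta>)" "Cmp PSh g \<theta> = \<eta>"
    using sheafification_ex1[OF \<theta>(1) F \<eta>_hom] by blast
  note hD = Sh_homD[OF h(1)] and gD = Sh_homD[OF g(1)]
  have "Cmp PSh (Cmp Sh g h) \<eta> = \<eta>"
    using P.cmp_assoc[OF \<eta>_hom hD(5) gD(5)] h g by simp
  moreover have "Cmp PSh (Ide Sh (target \<eta>)) \<eta> = \<eta>"
    using P.cmp_ide_left[OF \<eta>_hom] by simp
  \<comment> \<open>Both arrows factor \<open>\<eta>\<close> through itself, so the universal
    property of \<open>\<eta>\<close> identifies them.\<close>
  ultimately have gh: "Cmp Sh g h = Ide Sh (target \<eta>)"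
    using sheafification_ex1[OF \<eta> F \<eta>_hom] S.cmp_in_hom[OF h(1) g(1)] S.ide_in_hom[of "target \<eta>"] F
    by auto
  show ?thesis
    unfolding bij_betw_def
  proof
    show "inj_on (underlying \<eta> k) (sec Q k)"
    proof (rule inj_onI)
      fix x y assume xy: "x \<in> sec Q k" "y \<in> sec Q k" "underlying \<eta> k x = underlying \<eta> k y"
      have "underlying \<theta> k x = underlying \<theta> k y"
        unfolding h(2)[symmetric] using xy \<eta>D(1) by simp
      then show "x = y" using \<theta>(2) xy by (auto simp: bij_betw_def inj_on_def)
    qed
    show "underlying \<eta> k ` sec Q k = sec (target \<eta>) k"
    proof
      show "underlying \<eta> k ` sec Q k \<subseteq> sec (target \<eta>) k" using \<eta>D(5) by blast
      show "sec (target \<eta>) k \<subseteq> underlying \<eta> k ` sec Q k"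
      proof
        fix w assume w: "w \<in> sec (target \<eta>) k"
        then obtain x where x: "x \<in> sec Q k" "underlying h k w = underlying \<theta> k x"
          using hD(6)[OF w] \<theta>(2) by (auto simp: bij_betw_def)
        have "w = underlying (Cmp Sh g h) k w" unfolding gh using w by simp
        also have "\<dots> = underlying g k (underlying \<theta> k x)" using w x hD(1) by simp
        also have "\<dots> = underlying \<eta> k x"
          using arg_cong[OF g(2), of "\<lambda>f. underlying f k x"] x(1) PSh_homD(1)[OF \<theta>_hom] by simp
        finally show "w \<in> underlying \<eta> k ` sec Q k" using x by blast
      qed
    qed
  qed
qed

lemma sheafify_unit_hom:
  fixes Q :: "('a, 'u) presheaf"
  assumes "is_presheaf Q"
  shows "sheafify_unit Q \<in> hom PSh Q (on_Ob sheafify Q)" "is_sheaf (on_Ob sheafify Q)"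
  using sheafification_unit[OF assms] by (auto simp: is_sheafification_def sheafify_def)

lemma sheafify_Ar_ex1:
  fixes f :: "('a, 'u) psh_arrow"
  assumes f: "f \<in> hom PSh P Q"
  shows "\<exists>!g. g \<in> hom Sh (on_Ob sheafify P) (on_Ob sheafify Q) \<and>
    Cmp PSh g (sheafify_unit P) = Cmp PSh (sheafify_unit Q) f"
proof -
  interpret P: category "PSh :: (('a, 'u) presheaf, ('a, 'u) psh_arrow) cat" by (rule PSh_category)
  note fD = PSh_homD[OF f]
  show ?thesis
    using sheafification_ex1[OF sheafification_unit[OF fD(3)] sheafify_unit_hom(2)[OF fD(4)]
        P.cmp_in_hom[OF f sheafify_unit_hom(1)[OF fD(4)]]]
    by (simp add: sheafify_def)
qed

lemma sheafify_Ar: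
  fixes f :: "('a, 'u) psh_arrow"
  assumes f: "f \<in> hom PSh P Q"
  shows "on_Ar sheafify f \<in> hom Sh (on_Ob sheafify P) (on_Ob sheafify Q)"
    "Cmp PSh (on_Ar sheafify f) (sheafify_unit P) = Cmp PSh (sheafify_unit Q) f"
proof -
  have "on_Ar sheafify f = (THE g. g \<in> hom Sh (on_Ob sheafify P) (on_Ob sheafify Q) \<and>
    Cmp PSh g (sheafify_unit P) = Cmp PSh (sheafify_unit Q) f)"
    using PSh_homD[OF f] by (simp add: sheafify_def)
  then show "on_Ar sheafify f \<in> hom Sh (on_Ob sheafify P) (on_Ob sheafify Q)"
    "Cmp PSh (on_Ar sheafify f) (sheafify_unit P) = Cmp PSh (sheafify_unit Q) f"
    using theI'[OF sheafify_Ar_ex1[OF f]] by simp_all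
qed

text \<open>Both sides of each functor law make the same square with the units commute, and such an
  arrow is unique.\<close>

lemma sheafify_functor: "is_functor PSh Sh (sheafify :: (('a, 'u) presheaf, _, _, _) fctr)"
proof -
  interpret S: category "Sh :: (('a, 'u) presheaf, ('a, 'u) psh_arrow) cat" by (rule Sh_category)
  interpret P: category "PSh :: (('a, 'u) presheaf, ('a, 'u) psh_arrow) cat" by (rule PSh_category)
  have ide: "on_Ar sheafify (Ide PSh X) = Ide Sh (on_Ob sheafify X)" if "is_presheaf X" for X :: "('a, 'u) presheaf"
  proof -
    have i: "Ide PSh X \<in> hom PSh X X" using P.ide_in_hom that by simp
    note \<eta> = sheafify_unit_hom[OF that]
    have "Ide Sh (on_Ob sheafify X) \<in> hom Sh (on_Ob sheafify X) (on_Ob sheafify X)"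
      using S.ide_in_hom \<eta>(2) by simp
    moreover have "Cmp PSh (Ide Sh (on_Ob sheafify X)) (sheafify_unit X) = Cmp PSh (sheafify_unit X) (Ide PSh X)"
      using P.cmp_ide_left[OF \<eta>(1)] P.cmp_ide_right[OF \<eta>(1)] by simp
    ultimately show ?thesis using sheafify_Ar_ex1[OF i] sheafify_Ar[OF i] by blast
  qed
  have cmp: "on_Ar sheafify (Cmp PSh g f) = Cmp Sh (on_Ar sheafify g) (on_Ar sheafify f)"
    if f: "f \<in> hom PSh X Y" and g: "g \<in> hom PSh Y Z" for f g :: "('a, 'u) psh_arrow" and X Y Z
  proof -
    note gf = P.cmp_in_hom[OF f g]
    note \<eta>X = sheafify_unit_hom[OF PSh_homD(3)[OF f]] and \<eta>Y = sheafify_unit_hom[OF PSh_homD(4)[OF f]]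
      and \<eta>Z = sheafify_unit_hom[OF PSh_homD(4)[OF g]]
    note F = sheafify_Ar[OF f] and G = sheafify_Ar[OF g]
    note FD = Sh_homD(5)[OF F(1)] and GD = Sh_homD(5)[OF G(1)]
    have "Cmp PSh (Cmp Sh (on_Ar sheafify g) (on_Ar sheafify f)) (sheafify_unit X) =
      Cmp PSh (sheafify_unit Z) (Cmp PSh g f)"
      using P.cmp_assoc[OF \<eta>X(1) FD GD] P.cmp_assoc[OF f \<eta>Y(1) GD] P.cmp_assoc[OF f g \<eta>Z(1)] F(2) G(2)
      by simp
    then show ?thesis
      using sheafify_Ar_ex1[OF gf] sheafify_Ar[OF gf] S.cmp_in_hom[OF F(1) G(1)] by blast
  qed
  show ?thesis
    using S.category_axioms P.category_axioms sheafify_unit_hom(2) sheafify_Ar(1) ide cmp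
    by (simp add: is_functor_def)
qed

section \<open>The later endofunctor and next on sheaves\<close>

lemma precomp_pred_sec [simp]: "sec (on_Ob (precomp_pred K) X) a = sec X (pred_join K a)"
  by (simp add: precomp_pred_def)

lemma precomp_pred_res [simp]:
  "res (on_Ob (precomp_pred K) X) a b = res X (pred_join K a) (pred_join K b)"
  by (simp add: precomp_pred_def)

lemma precomp_pred_Ar [simp]:
  "source (on_Ar (precomp_pred K) f) = on_Ob (precomp_pred K) (source f)"
  "target (on_Ar (precomp_pred K) f) = on_Ob (precomp_pred K) (target f)"
  "underlying (on_Ar (precomp_pred K) f) a = underlying f (pred_join K a)"
  by (simp_all add: precomp_pred_def)

lemma precomp_pred_presheaf: "is_presheaf X \<Longrightarrow> is_presheaf (on_Ob (precomp_pred K) X)"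
  by (subst is_presheaf_def) (auto simp: res_in res_id res_res pred_join_mono)

lemma precomp_pred_hom:
  "f \<in> hom PSh X Y \<Longrightarrow> on_Ar (precomp_pred K) f \<in> hom PSh (on_Ob (precomp_pred K) X) (on_Ob (precomp_pred K) Y)"
  by (auto simp: PSh_hom_iff precomp_pred_presheaf pred_join_mono)

lemma precomp_pred_functor: "is_functor Sh PSh (precomp_pred K :: (('a, 'u) presheaf, _, _, _) fctr)"
proof -
  interpret S: category "Sh :: (('a, 'u) presheaf, ('a, 'u) psh_arrow) cat" by (rule Sh_category)
  interpret P: category "PSh :: (('a, 'u) presheaf, ('a, 'u) psh_arrow) cat" by (rule PSh_category)
  have "on_Ar (precomp_pred K) (Ide PSh X) = Ide PSh (on_Ob (precomp_pred K) X)" for X :: "('a, 'u) presheaf"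
    by (simp add: PSh_def precomp_pred_def)
  moreover have "on_Ar (precomp_pred K) (Cmp PSh g f) =
      Cmp PSh (on_Ar (precomp_pred K) g) (on_Ar (precomp_pred K) f)" for f g :: "('a, 'u) psh_arrow"
    by (simp add: PSh_def precomp_pred_def)
  moreover have "\<forall>X Y. \<forall>f\<in>hom Sh X Y. on_Ar (precomp_pred K) f \<in>
      hom PSh (on_Ob (precomp_pred K) X) (on_Ob (precomp_pred K) (Y :: ('a, 'u) presheaf))"
    using precomp_pred_hom Sh_homD(5) by blast
  ultimately show ?thesis
    using S.category_axioms P.category_axioms
    by (simp add: is_functor_def precomp_pred_presheaf is_sheaf_presheaf)
qed

lemma later_functor: "is_functor Sh Sh (later K :: (('a, 'u) presheaf, _, _, _) fctr)"
  unfolding later_def by (rule is_functor_comp[OF precomp_pred_functor sheafify_functor])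

abbreviation later_unit :: "('a, 'u) presheaf \<Rightarrow> ('a, 'u) psh_arrow" where
  "later_unit X \<equiv> sheafify_unit (on_Ob (precomp_pred K) X)"

lemma later_unit_hom:
  assumes "is_sheaf X"
  shows "later_unit X \<in> hom PSh (on_Ob (precomp_pred K) X) (on_Ob (later K) X)"
    "is_sheaf (on_Ob (later K) X)"
  using sheafify_unit_hom[OF precomp_pred_presheaf[OF is_sheaf_presheaf[OF assms]]]
  by (simp_all add: later_def comp_fctr_def)

text \<open>This is the working description of \<open>later K\<close>: over a prime, its sections
  are coded by sections over the predecessor join. The unit stays explicit because the target is
  merely a chosen sheaf.\<close>

lemma later_unit_bij:
  assumes "is_sheaf X" "k \<in> primes"
  shows "bij_betw (underlying (later_unit X) k) (sec X (pred_join K k)) (sec (on_Ob (later K) X) k)"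
  using sheafification_bij[OF sheafification_unit[OF precomp_pred_presheaf[OF is_sheaf_presheaf[OF assms(1)]]] assms(2)]
    PSh_homD(2)[OF later_unit_hom(1)[OF assms(1)]]
  by simp

lemma later_unit_natural:
  assumes f: "f \<in> hom Sh X Y" and x: "x \<in> sec X (pred_join K a)"
  shows "underlying (on_Ar (later K) f) a (underlying (later_unit X) a x) =
    underlying (later_unit Y) a (underlying f (pred_join K a) x)"
proof -
  note fD = Sh_homD[OF f]
  have "Cmp PSh (on_Ar (later K) f) (later_unit X) = Cmp PSh (later_unit Y) (on_Ar (precomp_pred K) f)"
    using sheafify_Ar(2)[OF precomp_pred_hom[OF fD(5)]] by (simp add: later_def comp_fctr_def)
  from arg_cong[OF this, of "\<lambda>g. underlying g a x"] show ?thesis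
    using x fD(1) PSh_homD(1)[OF later_unit_hom(1)[OF fD(3)]] by simp
qed

lemma next_pre_hom:
  assumes X: "is_presheaf X"
  shows "next_pre K X \<in> hom PSh X (on_Ob (precomp_pred K) X)"
proof -
  have "next_pre K X = psh_map X (on_Ob (precomp_pred K) X) (\<lambda>a x. res X a (pred_join K a) x)"
    by (simp add: next_pre_def psh_map_def)
  then show ?thesis
    using X by (auto intro!: psh_map_hom simp: precomp_pred_presheaf res_in res_res pred_join_le pred_join_mono
        order_trans[OF pred_join_le])
qed

text \<open>Naturality of the unit at \<open>next_pre K X\<close> trades the unit of
  \<open>X\<close> for that of the target, so \<open>next_sh\<close> can be evaluated without
  inverting a unit.\<close>

lemma next_sh_eq:
  fixes X :: "('a, 'u) presheaf"
  assumes "is_sheaf X"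
  shows "next_sh K X = Cmp PSh (later_unit X) (next_pre K X)"
  using sheafify_Ar(2)[OF next_pre_hom[OF is_sheaf_presheaf[OF assms]]] by (simp add: next_sh_def)

lemma next_sh_hom:
  fixes X :: "('a, 'u) presheaf"
  assumes X: "is_sheaf X"
  shows "next_sh K X \<in> hom Sh X (on_Ob (later K) X)"
proof -
  interpret P: category "PSh :: (('a, 'u) presheaf, ('a, 'u) psh_arrow) cat" by (rule PSh_category)
  show ?thesis
    unfolding next_sh_eq[OF X] Sh_hom_iff
    using P.cmp_in_hom[OF next_pre_hom[OF is_sheaf_presheaf[OF X]] later_unit_hom(1)[OF X]] later_unit_hom(2)[OF X] X
    by simp
qed

lemma next_sh_apply:
  fixes X :: "('a, 'u) presheaf"
  assumes X: "is_sheaf X" and x: "x \<in> sec X a"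
  shows "underlying (next_sh K X) a x = underlying (later_unit X) a (res X a (pred_join K a) x)"
  unfolding next_sh_eq[OF X] using x by (simp add: next_pre_def)

lemma next_sh_natural:
  "is_nat_trans Sh Sh id_fctr (later K) (next_sh K :: ('a, 'u) presheaf \<Rightarrow> _)"
proof -
  interpret S: category "Sh :: (('a, 'u) presheaf, ('a, 'u) psh_arrow) cat" by (rule Sh_category)
  have "Cmp Sh (next_sh K Y) f = Cmp Sh (on_Ar (later K) f) (next_sh K X)"
    if f: "f \<in> hom Sh X Y" for f :: "('a, 'u) psh_arrow" and X Y
  proof -
    note fD = Sh_homD[OF f]
    note nX = next_sh_hom[OF fD(3)] and nY = next_sh_hom[OF fD(4)]
    have Lf: "on_Ar (later K) f \<in> hom Sh (on_Ob (later K) X) (on_Ob (later K) Y)"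
      using later_functor f by (simp add: is_functor_def)
    show ?thesis
    proof (rule Sh_hom_eqI[OF S.cmp_in_hom[OF f nY] S.cmp_in_hom[OF nX Lf]])
      fix a x assume x: "x \<in> sec X a"
      have "underlying (next_sh K Y) a (underlying f a x) =
        underlying (on_Ar (later K) f) a (underlying (next_sh K X) a x)"
        using next_sh_apply[OF fD(4) fD(6)[OF x]] next_sh_apply[OF fD(3) x] fD(7)[OF pred_join_le x]
          later_unit_natural[OF f res_in[OF is_sheaf_presheaf[OF fD(3)] pred_join_le x]]
        by simp
      then show "underlying (Cmp Sh (next_sh K Y) f) a x =
        underlying (Cmp Sh (on_Ar (later K) f) (next_sh K X)) a x"
        using x fD(1) Sh_homD(1)[OF nX] by simp
    qed
  qed
  then show ?thesis
    using later_functor S.category_axioms next_sh_hom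
    by (simp add: is_nat_trans_def is_functor_def id_fctr_def)
qed

lemma pointed_endofunctor_later:
  assumes "is_sheaf (I :: ('a, 'u) presheaf)"
  shows "pointed_endofunctor Sh (later K) (next_sh K) I"
proof -
  interpret S: category "Sh :: (('a, 'u) presheaf, ('a, 'u) psh_arrow) cat" by (rule Sh_category)
  show ?thesis
  proof
    show "\<exists>p q. is_pullback Sh f g p q" if "f \<in> Ar Sh" "g \<in> Ar Sh" "Tgt Sh f = Tgt Sh g"
      for f g :: "('a, 'u) psh_arrow"
      by (rule Sh_pullback_exists[OF infinite_universe, of f "source f" "target f" g "source g"])
        (use that in \<open>auto simp: hom_def\<close>)
  qed (use next_sh_natural assms in auto)
qed

end

section \<open>Limits and fixed points in slices of the category of sheaves\<close>

lemma Sh_cmp_apply: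
  "f \<in> hom Sh X Y \<Longrightarrow> x \<in> sec X a \<Longrightarrow>
    underlying (Cmp PSh g f) a x = underlying g a (underlying f a x)"
  using Sh_homD(1)[of f X Y] by simp

locale wf_basis_slice = wf_basis_universe K d
  for K :: "'a :: complete_heyting_algebra set" and d :: "('a \<Rightarrow> 'u) \<Rightarrow> 'u" +
  fixes I :: "('a, 'u) presheaf"
  assumes base_sheaf: "is_sheaf I"
begin

sublocale pointed_endofunctor Sh "later K" "next_sh K" I
  by (rule pointed_endofunctor_later[OF base_sheaf])

abbreviation slice_I where "slice_I \<equiv> slice Sh I"

abbreviation later_I where "later_I \<equiv> slice_later Sh (later K) (next_sh K) I"

abbreviation next_I where "next_I \<equiv> slice_next Sh (later K) (next_sh K) I"

lemma slice_Sh_Ob_iff: "p \<in> Ob slice_I \<longleftrightarrow> p \<in> hom Sh (source p) I"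
  by (simp add: slice_Ob_iff)

lemma slice_Sh_homD:
  assumes "f \<in> hom slice_I p q"
  shows "source f = p" "target f = q" "p \<in> hom Sh (source p) I" "q \<in> hom Sh (source q) I"
    "underlying f \<in> hom Sh (source p) (source q)"
    "x \<in> sec (source p) a \<Longrightarrow> underlying q a (underlying (underlying f) a x) = underlying p a x"
proof -
  note fD = slice_homD[OF assms, simplified]
  show "source f = p" "target f = q" "p \<in> hom Sh (source p) I" "q \<in> hom Sh (source q) I"
    "underlying f \<in> hom Sh (source p) (source q)" by (fact fD)+
  show "x \<in> sec (source p) a \<Longrightarrow> underlying q a (underlying (underlying f) a x) = underlying p a x"
    using Sh_cmp_apply[OF fD(5), of x a q] fD(6) by simp
qed

lemma slice_Sh_homI:
  assumes p: "p \<in> hom Sh (source p) I" and q: "q \<in> hom Sh (source q) I"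
    and u: "u \<in> hom Sh (source p) (source q)"
    and eq: "\<And>a x. x \<in> sec (source p) a \<Longrightarrow> underlying q a (underlying u a x) = underlying p a x"
  shows "Arrow p q u \<in> hom slice_I p q"
proof -
  have "Cmp Sh q u = p"
    by (rule Sh_hom_eqI[OF cmp_in_hom[OF u q] p]) (use eq Sh_cmp_apply[OF u] in simp)
  then show ?thesis using p q u by (simp add: slice_hom_iff slice_Sh_Ob_iff)
qed

lemma slice_Sh_cmp_eq_iff:
  assumes f: "f \<in> hom slice_I p q" and g: "g \<in> hom slice_I q r" and h: "h \<in> hom slice_I p r"
  shows "Cmp slice_I g f = h \<longleftrightarrow>
    (\<forall>a. \<forall>x\<in>sec (source p) a.
      underlying (underlying g) a (underlying (underlying f) a x) = underlying (underlying h) a x)"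
proof -
  interpret S: category slice_I by (rule slice_category)
  note fD = slice_Sh_homD[OF f] and gD = slice_Sh_homD[OF g] and hD = slice_Sh_homD[OF h]
  have gf: "Cmp Sh (underlying g) (underlying f) \<in> hom Sh (source p) (source r)"
    by (rule cmp_in_hom[OF fD(5) gD(5)])
  have "Cmp slice_I g f = h \<longleftrightarrow> Cmp Sh (underlying g) (underlying f) = underlying h"
    using fD(1) gD(2) hD(1,2) by (cases h) auto
  also have "\<dots> \<longleftrightarrow> (\<forall>a. \<forall>x\<in>sec (source p) a.
      underlying (Cmp Sh (underlying g) (underlying f)) a x = underlying (underlying h) a x)"
    using Sh_hom_eqI[OF gf hD(5)] by metis
  finally show ?thesis using Sh_cmp_apply[OF fD(5)] by simp
qed

section \<open>Sections of the later object, and limits in a slice\<close>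

lemma later_I_square:
  assumes p: "p \<in> hom Sh Y I"
  shows "slice_later_fst p \<in> hom Sh (source (slice_later_fst p)) I"
    "slice_later_snd p \<in> hom Sh (source (slice_later_fst p)) (on_Ob (later K) Y)"
  using slice_later_square[OF p] by simp_all

text \<open>Sections of the chosen pullback are matching pairs, and naturality of the unit reduces
  the matching condition to \<open>eq\<close>. With \<open>later_I_section_cases\<close> this gives
  coordinates \<open>i\<close> and \<open>y\<close> for sections over a prime.\<close>

lemma later_I_section_ex1:
  assumes p: "p \<in> hom Sh Y I" and i: "i \<in> sec I k"
    and y: "y \<in> sec Y (pred_join K k)" and eq: "underlying p (pred_join K k) y = res I k (pred_join K k) i"
  shows "\<exists>!w. w \<in> sec (source (slice_later_fst p)) k \<and> underlying (slice_later_fst p) k w = i \<and>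
    underlying (slice_later_snd p) k w = underlying (later_unit Y) k y"
proof (rule Sh_pullback_sections[OF slice_pullback[OF p]])
  note pD = Sh_homD[OF p]
  show "i \<in> sec (source (next_sh K I)) k"
    using i Sh_homD(1)[OF next_sh_hom[OF base_sheaf]] by simp
  have "source (on_Ar (later K) p) = on_Ob (later K) Y"
    using L_hom[OF p] by (rule Sh_homD(1))
  then show "underlying (later_unit Y) k y \<in> sec (source (on_Ar (later K) p)) k"
    using PSh_homD(5)[OF later_unit_hom(1)[OF pD(3)], of y k] y by simp
  show "underlying (next_sh K I) k i = underlying (on_Ar (later K) p) k (underlying (later_unit Y) k y)"
    using next_sh_apply[OF base_sheaf i] later_unit_natural[OF p y] eq by simp
qed

text \<open>Surjectivity of the unit at \<open>Y\<close> over the prime \<open>k\<close> produces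
  \<open>y\<close>. The pullback square only compares images in the later object of
  \<open>I\<close>; injectivity of the unit at \<open>I\<close> brings this back to sections over
  \<open>pred_join K k\<close>.\<close>

lemma later_I_section_cases:
  assumes p: "p \<in> hom Sh Y I" and k: "k \<in> primes" and w: "w \<in> sec (source (slice_later_fst p)) k"
  obtains y where "y \<in> sec Y (pred_join K k)"
    "underlying p (pred_join K k) y = res I k (pred_join K k) (underlying (slice_later_fst p) k w)"
    "underlying (slice_later_snd p) k w = underlying (later_unit Y) k y"
proof -
  note pD = Sh_homD[OF p] and r = later_I_square(1)[OF p] and s = later_I_square(2)[OF p]
  note rw = Sh_homD(6)[OF r w]
  obtain y where y: "y \<in> sec Y (pred_join K k)"
    "underlying (slice_later_snd p) k w = underlying (later_unit Y) k y"
    using Sh_homD(6)[OF s w] later_unit_bij[OF pD(3) k] by (auto simp: bij_betw_def)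
  have "underlying (next_sh K I) k (underlying (slice_later_fst p) k w) =
    underlying (on_Ar (later K) p) k (underlying (slice_later_snd p) k w)"
    using arg_cong[OF slice_later_square(3)[OF p], of "\<lambda>f. underlying f k w"]
      Sh_cmp_apply[OF r w] Sh_cmp_apply[OF s w] by simp
  then have "underlying (later_unit I) k (res I k (pred_join K k) (underlying (slice_later_fst p) k w)) =
    underlying (later_unit I) k (underlying p (pred_join K k) y)"
    using next_sh_apply[OF base_sheaf rw] later_unit_natural[OF p y(1)] y(2) by simp
  then have "underlying p (pred_join K k) y = res I k (pred_join K k) (underlying (slice_later_fst p) k w)"
    using later_unit_bij[OF base_sheaf k] pD(6)[OF y(1)]
      res_in[OF is_sheaf_presheaf[OF base_sheaf] pred_join_le rw]
    by (auto simp: bij_betw_def inj_on_def)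
  with y show thesis by (intro that)
qed

text \<open>A cone over \<open>E\<close> with vertex the section \<open>i\<close>, written
  elementwise. The base section is recorded because for an empty diagram it is the only datum, the
  identity of \<open>I\<close> being terminal in the slice.\<close>

definition compatible_family ::
  "('i, 'j) cat \<Rightarrow> ('i, 'j, ('a, 'u) psh_arrow, (('a, 'u) psh_arrow, ('a, 'u) psh_arrow) arrow) fctr \<Rightarrow>
    'a \<Rightarrow> 'u \<Rightarrow> ('i \<Rightarrow> 'u) \<Rightarrow> bool" where
  "compatible_family J E a i y \<longleftrightarrow> i \<in> sec I a \<and>
     (\<forall>j\<in>Ob J. y j \<in> sec (source (on_Ob E j)) a \<and> underlying (on_Ob E j) a (y j) = i) \<and>
     (\<forall>j j'. \<forall>u\<in>hom J j j'. underlying (underlying (on_Ar E u)) a (y j) = y j')"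

text \<open>The section \<open>i\<close> is itself an object of the slice,
  \<open>section_map I a i\<close>, and a compatible family is a cone from this object. Here
  \<open>a\<close> is arbitrary, so that the lemma can be used at
  \<open>pred_join K k\<close>.\<close>

lemma limit_cone_sections:
  assumes E: "is_functor J slice_I E" and lim: "is_limit_cone J slice_I E L \<pi>"
    and fam: "compatible_family J E a i y"
  shows "\<exists>!l. l \<in> sec (source L) a \<and> underlying L a l = i \<and>
    (\<forall>j\<in>Ob J. underlying (underlying (\<pi> j)) a l = y j)"
proof -
  interpret J: category J using E by (simp add: is_functor_def)
  have i: "i \<in> sec I a" and y: "\<And>j. j \<in> Ob J \<Longrightarrow> y j \<in> sec (source (on_Ob E j)) a"
    "\<And>j. j \<in> Ob J \<Longrightarrow> underlying (on_Ob E j) a (y j) = i"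
    and yu: "\<And>j j' u. u \<in> hom J j j' \<Longrightarrow> underlying (underlying (on_Ar E u)) a (y j) = y j'"
    using fam by (auto simp: compatible_family_def)
  have Ej: "on_Ob E j \<in> hom Sh (source (on_Ob E j)) I" if "j \<in> Ob J" for j
    using E that by (simp add: is_functor_def slice_Sh_Ob_iff)
  have \<pi>: "\<pi> j \<in> hom slice_I L (on_Ob E j)" if "j \<in> Ob J" for j
    using lim that by (simp add: is_limit_cone_def is_cone_def)
  have L: "L \<in> hom Sh (source L) I"
    using lim by (simp add: is_limit_cone_def is_cone_def slice_Sh_Ob_iff)
  note LD = Sh_homD[OF L]
  let ?M = "section_map I a i"
  let ?\<sigma> = "\<lambda>q x. Arrow ?M q (section_map (source q) a x)"
  have M: "?M \<in> hom Sh (source ?M) I" using section_map_hom[OF base_sheaf i] by simp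
  have \<sigma>: "?\<sigma> q x \<in> hom slice_I ?M q"
    if q: "q \<in> hom Sh (source q) I" and x: "x \<in> sec (source q) a" "underlying q a x = i" for q x
  proof -
    have "Cmp Sh q (section_map (source q) a x) = ?M"
      using section_map_cmp[OF q x(1)] x(2) by simp
    then show ?thesis
      using M q section_map_hom[OF Sh_homD(3)[OF q] x(1)] by (simp add: slice_hom_iff slice_Sh_Ob_iff)
  qed
  have \<sigma>_cmp: "Cmp slice_I g (?\<sigma> q x) = ?\<sigma> q' (underlying (underlying g) a x)"
    if g: "g \<in> hom slice_I q q'" and x: "x \<in> sec (source q) a" for g q q' x
    using section_map_cmp[OF slice_Sh_homD(5)[OF g] x] slice_Sh_homD(2)[OF g] by simp
  have "is_cone J slice_I E ?M (\<lambda>j. ?\<sigma> (on_Ob E j) (y j))"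
    unfolding is_cone_def
  proof (intro conjI ballI allI)
    show "?M \<in> Ob slice_I" using M by (simp add: slice_Sh_Ob_iff)
    show "?\<sigma> (on_Ob E j) (y j) \<in> hom slice_I ?M (on_Ob E j)" if "j \<in> Ob J" for j
      by (rule \<sigma>[OF Ej[OF that] y(1)[OF that] y(2)[OF that]])
    show "Cmp slice_I (on_Ar E u) (?\<sigma> (on_Ob E j) (y j)) = ?\<sigma> (on_Ob E j') (y j')"
      if u: "u \<in> hom J j j'" for j j' u
    proof -
      have "on_Ar E u \<in> hom slice_I (on_Ob E j) (on_Ob E j')" using E u by (simp add: is_functor_def)
      from \<sigma>_cmp[OF this y(1)] show ?thesis using J.hom_Ob(1)[OF u] yu[OF u] by simp
    qed
  qed
  then have "\<exists>!h. h \<in> hom slice_I ?M L \<and> (\<forall>j\<in>Ob J. Cmp slice_I (\<pi> j) h = ?\<sigma> (on_Ob E j) (y j))"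
    using lim unfolding is_limit_cone_def by blast
  then obtain h where h: "h \<in> hom slice_I ?M L"
      "\<And>j. j \<in> Ob J \<Longrightarrow> Cmp slice_I (\<pi> j) h = ?\<sigma> (on_Ob E j) (y j)"
    and h_unique: "\<And>h'. h' \<in> hom slice_I ?M L \<Longrightarrow>
      (\<And>j. j \<in> Ob J \<Longrightarrow> Cmp slice_I (\<pi> j) h' = ?\<sigma> (on_Ob E j) (y j)) \<Longrightarrow> h' = h"
    by (metis (no_types, lifting))
  note hD = slice_Sh_homD[OF h(1)]
  have uh: "underlying h \<in> hom Sh (representable a) (source L)" using hD(5) by simp
  let ?l = "underlying (underlying h) a undefined"
  note l = hom_representable[OF uh]
  have h_eq: "h = ?\<sigma> L ?l" using hD(1,2) l(1) by (cases h) auto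
  show ?thesis
  proof
    have "underlying L a ?l = i"
      using hD(6)[of undefined a] section_map_apply[of a a I i] i res_id[OF is_sheaf_presheaf[OF base_sheaf] i]
      by (simp add: sec_representable)
    moreover have "underlying (underlying (\<pi> j)) a ?l = y j" if j: "j \<in> Ob J" for j
    proof -
      have "?\<sigma> (on_Ob E j) (underlying (underlying (\<pi> j)) a ?l) = ?\<sigma> (on_Ob E j) (y j)"
        using \<sigma>_cmp[OF \<pi>[OF j] l(2)] h(2)[OF j] h_eq by metis
      then show ?thesis
        using section_map_inject[OF Sh_homD(3)[OF Ej[OF j]] Sh_homD(6)[OF slice_Sh_homD(5)[OF \<pi>[OF j]] l(2)] y(1)[OF j]]
        by simp
    qed
    ultimately show "?l \<in> sec (source L) a \<and> underlying L a ?l = i \<and>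
      (\<forall>j\<in>Ob J. underlying (underlying (\<pi> j)) a ?l = y j)"
      using l(2) by blast
    fix l' assume l': "l' \<in> sec (source L) a \<and> underlying L a l' = i \<and>
      (\<forall>j\<in>Ob J. underlying (underlying (\<pi> j)) a l' = y j)"
    have "?\<sigma> L l' = h"
    proof (rule h_unique)
      show "?\<sigma> L l' \<in> hom slice_I ?M L" using \<sigma>[OF L] l' by blast
      show "Cmp slice_I (\<pi> j) (?\<sigma> L l') = ?\<sigma> (on_Ob E j) (y j)" if "j \<in> Ob J" for j
        using \<sigma>_cmp[OF \<pi>[OF that], of l'] l' that by metis
    qed
    then have "section_map (source L) a l' = section_map (source L) a ?l"
      using l(1) by (metis arrow.sel(3))
    then show "l' = ?l" using section_map_inject[OF LD(3)] l' l(2) by blast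
  qed
qed

text \<open>A cone from \<open>M\<close> prescribes, for each section of \<open>M\<close>, a base
  section and components. These conditions are local, so \<open>hom_by_local_relation\<close>
  reduces the mediating map to unique solutions over primes.\<close>

lemma limit_coneI:
  assumes E: "is_functor J slice_I E" and cone: "is_cone J slice_I E L \<pi>"
    and lim: "\<And>k i y. k \<in> primes \<Longrightarrow> compatible_family J E k i y \<Longrightarrow>
      \<exists>!l. l \<in> sec (source L) k \<and> underlying L k l = i \<and>
        (\<forall>j\<in>Ob J. underlying (underlying (\<pi> j)) k l = y j)"
  shows "is_limit_cone J slice_I E L \<pi>"
  unfolding is_limit_cone_def
proof (intro conjI cone allI impI)
  fix M \<rho> assume \<rho>_cone: "is_cone J slice_I E M \<rho>"
  have L: "L \<in> hom Sh (source L) I" and M: "M \<in> hom Sh (source M) I"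
    using cone \<rho>_cone by (simp_all add: is_cone_def slice_Sh_Ob_iff)
  have \<pi>: "\<pi> j \<in> hom slice_I L (on_Ob E j)" and \<rho>: "\<rho> j \<in> hom slice_I M (on_Ob E j)" if "j \<in> Ob J" for j
    using cone \<rho>_cone that by (simp_all add: is_cone_def)
  note LD = Sh_homD[OF L] and MD = Sh_homD[OF M]
  note pL = is_sheaf_presheaf[OF LD(3)] and pM = is_sheaf_presheaf[OF MD(3)]
    and pI = is_sheaf_presheaf[OF base_sheaf]
  note \<pi>D = slice_Sh_homD[OF \<pi>] and \<rho>D = slice_Sh_homD[OF \<rho>]
  let ?R = "\<lambda>a m l. underlying L a l = underlying M a m \<and>
    (\<forall>j\<in>Ob J. underlying (underlying (\<pi> j)) a l = underlying (underlying (\<rho> j)) a m)"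
  have "\<exists>!h. h \<in> hom Sh (source M) (source L) \<and> (\<forall>a. \<forall>m\<in>sec (source M) a. ?R a m (underlying h a m))"
  proof (rule hom_by_local_relation[OF MD(3) LD(3)])
    fix a m l assume m: "m \<in> sec (source M) a" and l: "l \<in> sec (source L) a"
    have "?R k (res (source M) a k m) (res (source L) a k l)" if R: "?R a m l" and k: "k \<in> below a" for k
    proof
      show "underlying L k (res (source L) a k l) = underlying M k (res (source M) a k m)"
        using k R LD(7)[OF _ l, of k] MD(7)[OF _ m, of k] by simp
      show "\<forall>j\<in>Ob J. underlying (underlying (\<pi> j)) k (res (source L) a k l) =
        underlying (underlying (\<rho> j)) k (res (source M) a k m)"
        using k R Sh_homD(7)[OF \<pi>D(5) _ l, of _ k] Sh_homD(7)[OF \<rho>D(5) _ m, of _ k] by simp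
    qed
    moreover have "?R a m l" if R: "\<forall>k\<in>below a. ?R k (res (source M) a k m) (res (source L) a k l)"
    proof (intro conjI ballI)
      show "underlying L a l = underlying M a m"
      proof (rule sheaf_basis_eqI[OF base_sheaf LD(6)[OF l] MD(6)[OF m]])
        fix k assume k: "k \<in> primes" "k \<le> a"
        then show "res I a k (underlying L a l) = res I a k (underlying M a m)"
          using R LD(7)[OF k(2) l] MD(7)[OF k(2) m] by simp
      qed
      fix j assume j: "j \<in> Ob J"
      note \<pi>j = Sh_homD[OF \<pi>D(5)[OF j]] and \<rho>j = Sh_homD[OF \<rho>D(5)[OF j]]
      show "underlying (underlying (\<pi> j)) a l = underlying (underlying (\<rho> j)) a m"
      proof (rule sheaf_basis_eqI[OF \<pi>j(4) \<pi>j(6)[OF l] \<rho>j(6)[OF m]])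
        fix k assume k: "k \<in> primes" "k \<le> a"
        then show "res (source (on_Ob E j)) a k (underlying (underlying (\<pi> j)) a l) =
          res (source (on_Ob E j)) a k (underlying (underlying (\<rho> j)) a m)"
          using R j \<pi>j(7)[OF k(2) l] \<rho>j(7)[OF k(2) m] by simp
      qed
    qed
    ultimately show "?R a m l \<longleftrightarrow> (\<forall>k\<in>below a. ?R k (res (source M) a k m) (res (source L) a k l))"
      by blast
  next
    fix k m assume k: "k \<in> primes" and m: "m \<in> sec (source M) k"
    have "compatible_family J E k (underlying M k m) (\<lambda>j. underlying (underlying (\<rho> j)) k m)"
      unfolding compatible_family_def
    proof (intro conjI ballI allI)
      show "underlying M k m \<in> sec I k" by (rule MD(6)[OF m])
      show "underlying (underlying (\<rho> j)) k m \<in> sec (source (on_Ob E j)) k"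
        "underlying (on_Ob E j) k (underlying (underlying (\<rho> j)) k m) = underlying M k m" if "j \<in> Ob J" for j
        using Sh_homD(6)[OF \<rho>D(5)[OF that] m] \<rho>D(6)[OF that m] by simp_all
      fix j j' u assume u: "u \<in> hom J j j'"
      interpret J: category J using E by (simp add: is_functor_def)
      have "on_Ar E u \<in> hom slice_I (on_Ob E j) (on_Ob E j')" "Cmp slice_I (on_Ar E u) (\<rho> j) = \<rho> j'"
        using E u \<rho>_cone by (simp_all add: is_functor_def is_cone_def del: slice_simps)
      then show "underlying (underlying (on_Ar E u)) k (underlying (underlying (\<rho> j)) k m) =
        underlying (underlying (\<rho> j')) k m"
        using slice_Sh_cmp_eq_iff[OF \<rho> _ \<rho>] J.hom_Ob[OF u] m by blast
    qed
    from lim[OF k this] show "\<exists>!l. l \<in> sec (source L) k \<and> ?R k m l" by simp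
  qed
  then obtain h where h: "h \<in> hom Sh (source M) (source L)"
      "\<And>a m. m \<in> sec (source M) a \<Longrightarrow> ?R a m (underlying h a m)"
    and h_unique: "\<And>g. g \<in> hom Sh (source M) (source L) \<Longrightarrow>
      (\<And>a m. m \<in> sec (source M) a \<Longrightarrow> ?R a m (underlying g a m)) \<Longrightarrow> g = h"
    by (metis (no_types, lifting))
  show "\<exists>!g. g \<in> hom slice_I M L \<and> (\<forall>j\<in>Ob J. Cmp slice_I (\<pi> j) g = \<rho> j)"
  proof
    have g: "Arrow M L h \<in> hom slice_I M L"
      by (rule slice_Sh_homI[OF M L h(1)]) (use h(2) in blast)
    have "Cmp slice_I (\<pi> j) (Arrow M L h) = \<rho> j" if "j \<in> Ob J" for j
      using slice_Sh_cmp_eq_iff[OF g \<pi>[OF that] \<rho>[OF that]] h(2) that by simp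
    then show "Arrow M L h \<in> hom slice_I M L \<and> (\<forall>j\<in>Ob J. Cmp slice_I (\<pi> j) (Arrow M L h) = \<rho> j)"
      using g by blast
    fix g assume g': "g \<in> hom slice_I M L \<and> (\<forall>j\<in>Ob J. Cmp slice_I (\<pi> j) g = \<rho> j)"
    then have g: "g \<in> hom slice_I M L" by blast
    note gD = slice_Sh_homD[OF g]
    have "underlying g = h"
    proof (rule h_unique[OF gD(5)])
      fix a m assume m: "m \<in> sec (source M) a"
      have "underlying (underlying (\<pi> j)) a (underlying (underlying g) a m) = underlying (underlying (\<rho> j)) a m"
        if "j \<in> Ob J" for j
        using slice_Sh_cmp_eq_iff[OF g \<pi>[OF that] \<rho>[OF that]] g' that m by blast
      then show "?R a m (underlying (underlying g) a m)" using gD(6)[OF m] by blast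
    qed
    then show "g = Arrow M L h" using gD(1,2) by (cases g) auto
  qed
qed

text \<open>Over a prime \<open>k\<close>, a compatible family for the later diagram splits into
  \<open>i\<close> over \<open>k\<close> and a family \<open>y\<close> for \<open>E\<close> over
  \<open>pred_join K k\<close>. The given limit has exactly one section \<open>l\<close> realising
  \<open>y\<close>, and the section with coordinates \<open>i\<close> and \<open>l\<close> is the
  wanted one.\<close>

lemma later_I_preserves_limit_cone:
  assumes E: "is_functor J slice_I E" and lim: "is_limit_cone J slice_I E L \<pi>"
  shows "is_limit_cone J slice_I (comp_fctr later_I E) (on_Ob later_I L) (\<lambda>j. on_Ar later_I (\<pi> j))"
proof (rule limit_coneI)
  interpret J: category J using E by (simp add: is_functor_def)
  have cone: "is_cone J slice_I E L \<pi>" using lim by (simp add: is_limit_cone_def)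
  show "is_functor J slice_I (comp_fctr later_I E)"
    by (rule is_functor_comp[OF E slice_later_functor])
  show "is_cone J slice_I (comp_fctr later_I E) (on_Ob later_I L) (\<lambda>j. on_Ar later_I (\<pi> j))"
    by (rule functor_preserves_cone[OF E slice_later_functor cone])
  have L: "L \<in> hom Sh (source L) I" using cone by (simp add: is_cone_def slice_Sh_Ob_iff)
  have Ej: "on_Ob E j \<in> hom Sh (source (on_Ob E j)) I" if "j \<in> Ob J" for j
    using E that by (simp add: is_functor_def slice_Sh_Ob_iff)
  have \<pi>: "\<pi> j \<in> hom slice_I L (on_Ob E j)" if "j \<in> Ob J" for j
    using cone that by (simp add: is_cone_def)
  fix k i w
  assume k: "k \<in> primes" and fam: "compatible_family J (comp_fctr later_I E) k i w"
  let ?p = "pred_join K k"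
  let ?r = "\<lambda>j. slice_later_fst (on_Ob E j)" and ?s = "\<lambda>j. slice_later_snd (on_Ob E j)"
  have i: "i \<in> sec I k" and w: "\<And>j. j \<in> Ob J \<Longrightarrow> w j \<in> sec (source (?r j)) k"
    "\<And>j. j \<in> Ob J \<Longrightarrow> underlying (?r j) k (w j) = i"
    and wu: "\<And>j j' u. u \<in> hom J j j' \<Longrightarrow> underlying (underlying (on_Ar later_I (on_Ar E u))) k (w j) = w j'"
    using fam by (auto simp: compatible_family_def comp_fctr_def slice_later_Ob)
  \<comment> \<open>In coordinates, the image of \<open>f\<close> under \<open>later_I\<close> acts
    on the second component as \<open>f\<close> over \<open>?p\<close>.\<close>
  have snd_later: "underlying (slice_later_snd q') k (underlying (underlying (on_Ar later_I f)) k v) =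
      underlying (later_unit (source q')) k (underlying (underlying f) ?p x)"
    if f: "f \<in> hom slice_I q q'" and x: "x \<in> sec (source q) ?p" and v: "v \<in> sec (source (slice_later_fst q)) k"
      and vx: "underlying (slice_later_snd q) k v = underlying (later_unit (source q)) k x" for f q q' x v
  proof -
    note fD = slice_Sh_homD[OF f]
    have "underlying (slice_later_snd q') k (underlying (underlying (on_Ar later_I f)) k v) =
      underlying (on_Ar (later K) (underlying f)) k (underlying (slice_later_snd q) k v)"
      using arg_cong[OF slice_later_Ar(2)[OF f], of "\<lambda>g. underlying g k v"] v
        Sh_cmp_apply[OF slice_Sh_homD(5)[OF slice_later_Ar(1)[OF f]] v]
        Sh_cmp_apply[OF later_I_square(2)[OF fD(3)] v]
      by simp
    then show ?thesis using vx later_unit_natural[OF fD(5) x] by simp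
  qed
  have unit_inj: "x = x'"
    if "is_sheaf X" "x \<in> sec X ?p" "x' \<in> sec X ?p"
      "underlying (later_unit X) k x = underlying (later_unit X) k x'" for X x x'
    using later_unit_bij[OF that(1) k] that by (auto simp: bij_betw_def inj_on_def)
  have "\<forall>j\<in>Ob J. \<exists>y. y \<in> sec (source (on_Ob E j)) ?p \<and> underlying (on_Ob E j) ?p y = res I k ?p i \<and>
      underlying (?s j) k (w j) = underlying (later_unit (source (on_Ob E j))) k y"
  proof
    fix j assume j: "j \<in> Ob J"
    obtain y where "y \<in> sec (source (on_Ob E j)) ?p"
      "underlying (on_Ob E j) ?p y = res I k ?p (underlying (?r j) k (w j))"
      "underlying (?s j) k (w j) = underlying (later_unit (source (on_Ob E j))) k y"
      by (rule later_I_section_cases[OF Ej[OF j] k w(1)[OF j]])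
    then show "\<exists>y. y \<in> sec (source (on_Ob E j)) ?p \<and> underlying (on_Ob E j) ?p y = res I k ?p i \<and>
      underlying (?s j) k (w j) = underlying (later_unit (source (on_Ob E j))) k y"
      using w(2)[OF j] by auto
  qed
  then obtain y where y: "\<And>j. j \<in> Ob J \<Longrightarrow> y j \<in> sec (source (on_Ob E j)) ?p"
    "\<And>j. j \<in> Ob J \<Longrightarrow> underlying (on_Ob E j) ?p (y j) = res I k ?p i"
    "\<And>j. j \<in> Ob J \<Longrightarrow> underlying (?s j) k (w j) = underlying (later_unit (source (on_Ob E j))) k (y j)"
    by metis
  have "compatible_family J E ?p (res I k ?p i) y"
    unfolding compatible_family_def
  proof (intro conjI ballI allI)
    show "res I k ?p i \<in> sec I ?p" by (rule res_in[OF is_sheaf_presheaf[OF base_sheaf] pred_join_le i])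
    show "y j \<in> sec (source (on_Ob E j)) ?p" "underlying (on_Ob E j) ?p (y j) = res I k ?p i"
      if "j \<in> Ob J" for j using y that by simp_all
    fix j j' u assume u: "u \<in> hom J j j'"
    note jO = J.hom_Ob[OF u]
    have Eu: "on_Ar E u \<in> hom slice_I (on_Ob E j) (on_Ob E j')" using E u by (simp add: is_functor_def)
    note EuD = Sh_homD[OF slice_Sh_homD(5)[OF Eu]]
    show "underlying (underlying (on_Ar E u)) ?p (y j) = y j'"
      by (rule unit_inj[OF EuD(4) EuD(6)[OF y(1)[OF jO(1)]] y(1)[OF jO(2)]])
        (use snd_later[OF Eu y(1)[OF jO(1)] w(1)[OF jO(1)] y(3)[OF jO(1)]] wu[OF u] y(3)[OF jO(2)] in simp)
  qed
  then have l_ex1: "\<exists>!l. l \<in> sec (source L) ?p \<and> underlying L ?p l = res I k ?p i \<and>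
      (\<forall>j\<in>Ob J. underlying (underlying (\<pi> j)) ?p l = y j)"
    by (rule limit_cone_sections[OF E lim])
  then obtain l where l: "l \<in> sec (source L) ?p" "underlying L ?p l = res I k ?p i"
      "\<And>j. j \<in> Ob J \<Longrightarrow> underlying (underlying (\<pi> j)) ?p l = y j"
    by blast
  have l_unique: "l' = l" if "l' \<in> sec (source L) ?p" "underlying L ?p l' = res I k ?p i"
      "\<And>j. j \<in> Ob J \<Longrightarrow> underlying (underlying (\<pi> j)) ?p l' = y j" for l'
    using l_ex1 l that by blast
  obtain v where v: "v \<in> sec (source (slice_later_fst L)) k" "underlying (slice_later_fst L) k v = i"
      "underlying (slice_later_snd L) k v = underlying (later_unit (source L)) k l"
    using later_I_section_ex1[OF L i l(1,2)] by blast
  have fst_later: "underlying (?r j) k (underlying (underlying (on_Ar later_I (\<pi> j))) k v') =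
      underlying (slice_later_fst L) k v'"
    if "j \<in> Ob J" "v' \<in> sec (source (slice_later_fst L)) k" for j v'
    by (rule slice_Sh_homD(6)[OF slice_later_Ar(1)[OF \<pi>[OF that(1)]] that(2)])
  have later_\<pi>: "underlying (underlying (on_Ar later_I (\<pi> j))) k v' \<in> sec (source (?r j)) k"
    if "j \<in> Ob J" "v' \<in> sec (source (slice_later_fst L)) k" for j v'
    by (rule Sh_homD(6)[OF slice_Sh_homD(5)[OF slice_later_Ar(1)[OF \<pi>[OF that(1)]]] that(2)])
  show "\<exists>!v. v \<in> sec (source (on_Ob later_I L)) k \<and> underlying (on_Ob later_I L) k v = i \<and>
    (\<forall>j\<in>Ob J. underlying (underlying (on_Ar later_I (\<pi> j))) k v = w j)"
    unfolding slice_later_Ob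
  proof
    have "underlying (underlying (on_Ar later_I (\<pi> j))) k v = w j" if j: "j \<in> Ob J" for j
    proof -
      have "underlying (?s j) k (underlying (underlying (on_Ar later_I (\<pi> j))) k v) =
        underlying (later_unit (source (on_Ob E j))) k (y j)"
        using snd_later[OF \<pi>[OF j] l(1) v(1,3)] l(3)[OF j] by simp
      \<comment> \<open>Both sections lie over \<open>i\<close> and have the second coordinate
        \<open>y j\<close>, so they coincide.\<close>
      then show ?thesis
        using later_I_section_ex1[OF Ej[OF j] i y(1)[OF j] y(2)[OF j]] fst_later[OF j v(1)] later_\<pi>[OF j v(1)]
          v(2) w[OF j] y(3)[OF j] by metis
    qed
    then show "v \<in> sec (source (slice_later_fst L)) k \<and> underlying (slice_later_fst L) k v = i \<and>
      (\<forall>j\<in>Ob J. underlying (underlying (on_Ar later_I (\<pi> j))) k v = w j)"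
      using v by blast
    fix v' assume v': "v' \<in> sec (source (slice_later_fst L)) k \<and> underlying (slice_later_fst L) k v' = i \<and>
      (\<forall>j\<in>Ob J. underlying (underlying (on_Ar later_I (\<pi> j))) k v' = w j)"
    then have v'_sec: "v' \<in> sec (source (slice_later_fst L)) k" by blast
    obtain l' where l': "l' \<in> sec (source L) ?p"
      "underlying L ?p l' = res I k ?p (underlying (slice_later_fst L) k v')"
      "underlying (slice_later_snd L) k v' = underlying (later_unit (source L)) k l'"
      by (rule later_I_section_cases[OF L k v'_sec])
    \<comment> \<open>A competing \<open>v'\<close> has coordinates \<open>i\<close> and
      \<open>l'\<close>, and \<open>l'\<close> solves the same limit problem over
      \<open>?p\<close>.\<close>
    have "l' = l"
    proof (rule l_unique[OF l'(1)])
      show "underlying L ?p l' = res I k ?p i" using l'(2) v' by simp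
      fix j assume j: "j \<in> Ob J"
      note \<pi>j = Sh_homD[OF slice_Sh_homD(5)[OF \<pi>[OF j]]]
      show "underlying (underlying (\<pi> j)) ?p l' = y j"
        by (rule unit_inj[OF \<pi>j(4) \<pi>j(6)[OF l'(1)] y(1)[OF j]])
          (use snd_later[OF \<pi>[OF j] l'(1) v'_sec l'(3)] v' y(3)[OF j] j in simp)
    qed
    then show "v' = v"
      using later_I_section_ex1[OF L i l(1,2)] v v' l'(3) by metis
  qed
qed

lemma later_I_preserves_finite_limits: "preserves_finite_limits slice_I slice_I later_I"
  using later_I_preserves_limit_cone by (auto simp: preserves_finite_limits_def)

section \<open>Guarded fixed points in a slice\<close>

lemma next_I_sections:
  assumes p: "p \<in> hom Sh Y I" and x: "x \<in> sec Y a"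
  shows "underlying (underlying (next_I p)) a x \<in> sec (source (slice_later_fst p)) a"
    "underlying (slice_later_fst p) a (underlying (underlying (next_I p)) a x) = underlying p a x"
    "underlying (slice_later_snd p) a (underlying (underlying (next_I p)) a x) =
      underlying (later_unit Y) a (res Y a (pred_join K a) x)"
    "b \<le> a \<Longrightarrow> res (source (slice_later_fst p)) a b (underlying (underlying (next_I p)) a x) =
      underlying (underlying (next_I p)) b (res Y a b x)"
proof -
  note n = slice_next_arrow[OF p] and pD = Sh_homD[OF p]
  note nD = slice_Sh_homD[OF n(1)]
  have N: "underlying (next_I p) \<in> hom Sh Y (source (slice_later_fst p))" using nD(5) pD(1) by simp
  show "underlying (underlying (next_I p)) a x \<in> sec (source (slice_later_fst p)) a"
    by (rule Sh_homD(6)[OF N x])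
  show "underlying (slice_later_fst p) a (underlying (underlying (next_I p)) a x) = underlying p a x"
    using nD(6)[of x a] pD(1) x by simp
  show "underlying (slice_later_snd p) a (underlying (underlying (next_I p)) a x) =
      underlying (later_unit Y) a (res Y a (pred_join K a) x)"
    using arg_cong[OF n(2), of "\<lambda>f. underlying f a x"] Sh_cmp_apply[OF N x] next_sh_apply[OF pD(3) x]
    by simp
  show "b \<le> a \<Longrightarrow> res (source (slice_later_fst p)) a b (underlying (underlying (next_I p)) a x) =
      underlying (underlying (next_I p)) b (res Y a b x)"
    by (rule Sh_homD(7)[OF N _ x])
qed

text \<open>A section of \<open>later_I p\<close> over a prime \<open>k\<close> amounts to one of \<open>I\<close> over \<open>k\<close> and one of \<open>p\<close> over
  \<open>pred_join K k\<close>, and \<open>next_I\<close> only depends on the latter data.\<close>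

lemma later_I_extend:
  assumes p: "p \<in> hom Sh Y I" and k: "k \<in> primes" and i: "i \<in> sec I k"
    and y: "y \<in> sec Y (pred_join K k)" and eq: "underlying p (pred_join K k) y = res I k (pred_join K k) i"
  obtains w where "w \<in> sec (source (slice_later_fst p)) k" "underlying (slice_later_fst p) k w = i"
    "res (source (slice_later_fst p)) k (pred_join K k) w = underlying (underlying (next_I p)) (pred_join K k) y"
    "\<And>x. x \<in> sec Y k \<Longrightarrow> underlying p k x = i \<Longrightarrow> res Y k (pred_join K k) x = y \<Longrightarrow>
      underlying (underlying (next_I p)) k x = w"
proof -
  let ?p = "pred_join K k"
  note pD = Sh_homD[OF p]
  note r = later_I_square(1)[OF p] and s = later_I_square(2)[OF p]
  note rD = Sh_homD[OF r] and sD = Sh_homD[OF s]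
  note pZ = is_sheaf_presheaf[OF rD(3)] and pY = is_sheaf_presheaf[OF pD(3)]
    and pI = is_sheaf_presheaf[OF base_sheaf]
  note \<eta>D = PSh_homD[OF later_unit_hom(1)[OF pD(3)]]
  obtain w where w: "w \<in> sec (source (slice_later_fst p)) k" "underlying (slice_later_fst p) k w = i"
      "underlying (slice_later_snd p) k w = underlying (later_unit Y) k y"
    using later_I_section_ex1[OF p i y eq] by blast
  show thesis
  proof
    \<comment> \<open>As \<open>?p\<close> need not be prime, the two sections are compared over the
      primes \<open>j\<close> below it, where their coordinates agree.\<close>
    show "res (source (slice_later_fst p)) k ?p w = underlying (underlying (next_I p)) ?p y"
    proof (rule sheaf_basis_eqI[OF rD(3) res_in[OF pZ pred_join_le w(1)] next_I_sections(1)[OF p y]])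
      fix j assume j: "j \<in> primes" "j \<le> ?p"
      have jk: "j \<le> k" using j(2) pred_join_le[of k] by (rule order_trans)
      have pj: "pred_join K j \<le> ?p" by (rule pred_join_mono[OF jk])
      have pjj: "pred_join K j \<le> j" by (rule pred_join_le)
      let ?y = "res Y ?p (pred_join K j) y"
      have "underlying p (pred_join K j) ?y = res I j (pred_join K j) (res I k j i)"
        using pD(7)[OF pj y] eq res_res[OF pI pj pred_join_le i] res_res[OF pI pjj jk i] by simp
      note ex1 = later_I_section_ex1[OF p res_in[OF pI jk i] res_in[OF pY pj y] this]
      let ?w = "res (source (slice_later_fst p)) k j w"
      let ?v = "underlying (underlying (next_I p)) j (res Y ?p j y)"
      have "?w \<in> sec (source (slice_later_fst p)) j" by (rule res_in[OF pZ jk w(1)])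
      moreover have "underlying (slice_later_fst p) j ?w = res I k j i"
        using rD(7)[OF jk w(1)] w(2) by simp
      moreover have "underlying (slice_later_snd p) j ?w = underlying (later_unit Y) j ?y"
        using sD(7)[OF jk w(1)] w(3) \<eta>D(6)[OF jk, of y] y by simp
      moreover note v = next_I_sections(1-3)[OF p res_in[OF pY j(2) y]]
      moreover have "underlying (slice_later_fst p) j ?v = res I k j i"
        using v(2) pD(7)[OF j(2) y] eq res_res[OF pI j(2) pred_join_le i] by simp
      moreover have "underlying (slice_later_snd p) j ?v = underlying (later_unit Y) j ?y"
        using v(3) res_res[OF pY pjj j(2) y] by simp
      ultimately have "?w = ?v" using ex1 by blast
      then show "res (source (slice_later_fst p)) ?p j (res (source (slice_later_fst p)) k ?p w) =
        res (source (slice_later_fst p)) ?p j (underlying (underlying (next_I p)) ?p y)"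
        using res_res[OF pZ j(2) pred_join_le w(1)] next_I_sections(4)[OF p y j(2)] by simp
    qed
    fix x assume x: "x \<in> sec Y k" "underlying p k x = i" "res Y k ?p x = y"
    show "underlying (underlying (next_I p)) k x = w"
      using later_I_section_ex1[OF p i y eq] w next_I_sections(1-3)[OF p x(1)] x by metis
  qed (fact w)+
qed

lemma guarded_fixpoint:
  assumes X: "X \<in> Ob slice_I" and f: "f \<in> hom slice_I (on_Ob later_I X) X" and T: "T \<in> Ob slice_I"
  shows "\<exists>!h. h \<in> hom slice_I T X \<and> Cmp slice_I f (Cmp slice_I (next_I X) h) = h"
proof -
  interpret S: category slice_I by (rule slice_category)
  have X: "X \<in> hom Sh (source X) I" and T: "T \<in> hom Sh (source T) I"
    using X T by (simp_all add: slice_Sh_Ob_iff)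
  have f: "f \<in> hom slice_I (slice_later_fst X) X" using f by (simp add: slice_later_Ob)
  note XD = Sh_homD[OF X] and TD = Sh_homD[OF T] and fD = slice_Sh_homD[OF f]
  note FD = Sh_homD[OF fD(5)] and r = later_I_square(1)[OF X]
  note pY = is_sheaf_presheaf[OF XD(3)] and pT = is_sheaf_presheaf[OF TD(3)]
    and pI = is_sheaf_presheaf[OF base_sheaf]
  note N = next_I_sections[OF X]
  let ?Y = "source X"
  define fN where "fN a x = underlying (underlying f) a (underlying (underlying (next_I X)) a x)" for a x
  have fN: "fN a x \<in> sec ?Y a" "underlying X a (fN a x) = underlying X a x" if "x \<in> sec ?Y a" for a x
    using FD(6)[OF N(1)[OF that]] fD(6)[OF N(1)[OF that]] N(2)[OF that] by (simp_all add: fN_def)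
  have fN_res: "res ?Y a b (fN a x) = fN b (res ?Y a b x)" if "x \<in> sec ?Y a" "b \<le> a" for a b x
    using FD(7)[OF that(2) N(1)[OF that(1)]] N(4)[OF that] by (simp add: fN_def)
  \<comment> \<open>The base section \<open>i\<close> is part of the relation because fixed points
    are unique only within a fibre. Locality holds since \<open>X\<close> and \<open>fN\<close>
    commute with restriction.\<close>
  define R where "R a i x \<longleftrightarrow> underlying X a x = i \<and> fN a x = x" for a i x
  have R_local: "R a i x \<longleftrightarrow> (\<forall>k\<in>below a. R k (res I a k i) (res ?Y a k x))"
    if i: "i \<in> sec I a" and x: "x \<in> sec ?Y a" for a i x
  proof
    show "\<forall>k\<in>below a. R k (res I a k i) (res ?Y a k x)" if "R a i x"
      using that XD(7)[OF _ x] fN_res[OF x] by (auto simp: R_def)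
    assume R: "\<forall>k\<in>below a. R k (res I a k i) (res ?Y a k x)"
    show "R a i x"
      unfolding R_def
    proof
      show "underlying X a x = i"
        by (rule sheaf_basis_eqI[OF base_sheaf XD(6)[OF x] i]) (use R XD(7)[OF _ x] in \<open>simp add: R_def\<close>)
      show "fN a x = x"
        by (rule sheaf_basis_eqI[OF XD(3) fN(1)[OF x] x]) (use R fN_res[OF x] in \<open>simp add: R_def\<close>)
    qed
  qed
  have R_ex1: "\<exists>!x. x \<in> sec ?Y k \<and> R k i x" if "k \<in> primes" "i \<in> sec I k" for k i
    using that
  proof (induction k arbitrary: i rule: wf_induct_rule[OF wf_less_basis])
    case (1 k)
    note k = 1(2) and i = 1(3)
    let ?p = "pred_join K k"
    let ?i = "res I k ?p i"
    note i' = res_in[OF pI pred_join_le i]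
    \<comment> \<open>The induction hypothesis covers the primes strictly below \<open>k\<close>,
      that is, those below \<open>?p\<close>; \<open>unique_section\<close> assembles their fixed
      points over \<open>?p\<close>. The trivial restriction from \<open>?p\<close> to itself only
      matches the form of \<open>Q\<close>.\<close>
    have "\<exists>!y. y \<in> sec ?Y ?p \<and> R ?p (res I ?p ?p ?i) y"
    proof (rule unique_section[OF XD(3), where Q = "\<lambda>b. R b (res I ?p b ?i)"])
      fix b y assume b: "b \<le> ?p" and y: "y \<in> sec ?Y b"
      show "R b (res I ?p b ?i) y \<longleftrightarrow> (\<forall>j\<in>below b. R j (res I ?p j ?i) (res ?Y b j y))"
        using R_local[OF res_in[OF pI b i'] y] by (simp add: res_res[OF pI _ b i'])
    next
      fix j assume j: "j \<in> primes" "j \<le> ?p"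
      then have "(j, k) \<in> {(j, k). j \<in> K \<and> k \<in> K \<and> j < k}"
        using k prime_le_pred_join_iff[OF k j(1)] by (auto simp: primes_def)
      then show "\<exists>!y. y \<in> sec ?Y j \<and> R j (res I ?p j ?i) y"
        using 1(1) j res_in[OF pI j(2) i'] by blast
    qed
    then obtain y where y: "y \<in> sec ?Y ?p" "underlying X ?p y = ?i" "fN ?p y = y"
      and y_unique: "\<And>y'. y' \<in> sec ?Y ?p \<Longrightarrow> underlying X ?p y' = ?i \<Longrightarrow> fN ?p y' = y' \<Longrightarrow> y' = y"
      unfolding R_def res_id[OF pI i'] by blast
    obtain w where w: "w \<in> sec (source (slice_later_fst X)) k" "underlying (slice_later_fst X) k w = i"
        "res (source (slice_later_fst X)) k ?p w = underlying (underlying (next_I X)) ?p y"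
      and next_eq: "\<And>x. x \<in> sec ?Y k \<Longrightarrow> underlying X k x = i \<Longrightarrow> res ?Y k ?p x = y \<Longrightarrow>
        underlying (underlying (next_I X)) k x = w"
      by (rule later_I_extend[OF X k i y(1,2)]) blast
    \<comment> \<open>A fixed point over \<open>i\<close> restricts to \<open>y\<close> on
      \<open>?p\<close>, so its image under \<open>next_I X\<close> is \<open>w\<close>. Hence the
      value of \<open>f\<close> at \<open>w\<close> is the only candidate.\<close>
    let ?x = "underlying (underlying f) k w"
    have x: "?x \<in> sec ?Y k" "underlying X k ?x = i" using FD(6)[OF w(1)] fD(6)[OF w(1)] w(2) by simp_all
    \<comment> \<open>Since \<open>f\<close> commutes with restriction and \<open>w\<close>
      restricts to the next of \<open>y\<close>, the left side is \<open>fN ?p y\<close>.\<close>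
    have "res ?Y k ?p ?x = y"
      using FD(7)[OF pred_join_le w(1)] w(3) y(3) by (simp add: fN_def)
    then have "fN k ?x = ?x" using next_eq[OF x] by (simp add: fN_def)
    moreover have "x' = ?x" if x': "x' \<in> sec ?Y k" "R k i x'" for x'
    proof -
      have "res ?Y k ?p x' = y"
        by (rule y_unique[OF res_in[OF pY pred_join_le x'(1)]])
          (use x' XD(7)[OF pred_join_le x'(1)] fN_res[OF x'(1) pred_join_le] in \<open>simp_all add: R_def\<close>)
      then show ?thesis using next_eq[OF x'(1)] x'(2) by (simp add: R_def fN_def)
    qed
    ultimately show ?case using x unfolding R_def by blast
  qed
  \<comment> \<open>Each section \<open>t\<close> of \<open>T\<close> is sent to the fixed point
    over its image in \<open>I\<close>.\<close>
  have "\<exists>!u. u \<in> hom Sh (source T) ?Y \<and>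
    (\<forall>a. \<forall>t\<in>sec (source T) a. R a (underlying T a t) (underlying u a t))"
  proof (rule hom_by_local_relation[OF TD(3) XD(3)])
    show "R a (underlying T a t) x \<longleftrightarrow>
      (\<forall>k\<in>below a. R k (underlying T k (res (source T) a k t)) (res ?Y a k x))"
      if "t \<in> sec (source T) a" "x \<in> sec ?Y a" for a t x
      using R_local[OF TD(6)[OF that(1)] that(2)] TD(7)[OF _ that(1)] by simp
    show "\<exists>!x. x \<in> sec ?Y k \<and> R k (underlying T k t) x" if "k \<in> primes" "t \<in> sec (source T) k" for k t
      by (rule R_ex1[OF that(1) TD(6)[OF that(2)]])
  qed
  then obtain u where u: "u \<in> hom Sh (source T) ?Y"
      "\<And>a t. t \<in> sec (source T) a \<Longrightarrow> R a (underlying T a t) (underlying u a t)"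
    and u_unique: "\<And>v. v \<in> hom Sh (source T) ?Y \<Longrightarrow>
      (\<And>a t. t \<in> sec (source T) a \<Longrightarrow> R a (underlying T a t) (underlying v a t)) \<Longrightarrow> v = u"
    by (metis (no_types, lifting))
  note n = slice_next_arrow(1)[OF X]
  have fixpoint_iff: "Cmp slice_I f (Cmp slice_I (next_I X) h) = h \<longleftrightarrow>
      (\<forall>a. \<forall>t\<in>sec (source T) a. fN a (underlying (underlying h) a t) = underlying (underlying h) a t)"
    if h: "h \<in> hom slice_I T X" for h
  proof -
    note nh = S.cmp_in_hom[OF h n]
    show ?thesis
      using slice_Sh_cmp_eq_iff[OF nh f h] Sh_cmp_apply[OF slice_Sh_homD(5)[OF h]] by (simp add: fN_def)
  qed
  show ?thesis
  proof
    have h: "Arrow T X u \<in> hom slice_I T X"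
      by (rule slice_Sh_homI[OF T X u(1)]) (use u(2) in \<open>auto simp: R_def\<close>)
    moreover have "Cmp slice_I f (Cmp slice_I (next_I X) (Arrow T X u)) = Arrow T X u"
      unfolding fixpoint_iff[OF h] using u(2) by (auto simp: R_def)
    ultimately show "Arrow T X u \<in> hom slice_I T X \<and>
      Cmp slice_I f (Cmp slice_I (next_I X) (Arrow T X u)) = Arrow T X u" by blast
    fix h assume h: "h \<in> hom slice_I T X \<and> Cmp slice_I f (Cmp slice_I (next_I X) h) = h"
    note hD = slice_Sh_homD[OF conjunct1[OF h]]
    have "underlying h = u"
    proof (rule u_unique[OF hD(5)])
      fix a t assume t: "t \<in> sec (source T) a"
      show "R a (underlying T a t) (underlying (underlying h) a t)"
        using fixpoint_iff[of h] h hD(6)[OF t] t by (auto simp: R_def simp del: slice_simps)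
    qed
    then show "h = Arrow T X u" using hD(1,2) by (cases h) auto
  qed
qed

lemma guarded_model_slice: "guarded_model slice_I later_I next_I"
  unfolding guarded_model_def
proof (intro conjI allI impI ballI)
  show "category slice_I" by (rule slice_category)
  show "has_finite_products slice_I" by (rule slice_has_finite_products[OF base pullbacks])
  show "is_functor slice_I slice_I later_I" by (rule slice_later_functor)
  show "preserves_finite_limits slice_I slice_I later_I" by (rule later_I_preserves_finite_limits)
  show "is_nat_trans slice_I slice_I id_fctr later_I next_I" by (rule slice_next_natural)
  show "\<exists>!h. h \<in> hom slice_I T X \<and> Cmp slice_I f (Cmp slice_I (next_I X) h) = h"
    if "is_terminal slice_I T" "X \<in> Ob slice_I" "f \<in> hom slice_I (on_Ob later_I X) X" for T X f
    by (rule guarded_fixpoint[OF that(2,3)]) (use that(1) in \<open>simp add: is_terminal_def\<close>)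
qed

end

theorem theorem8p14:
  fixes K :: "'a :: complete_heyting_algebra set"
    and I :: "('a, 'u) presheaf"
  assumes "infinite (UNIV :: 'u set)"
    and "\<exists>d :: ('a \<Rightarrow> 'u) \<Rightarrow> 'u. inj d"
    and "well_founded_basis K"
    and "I \<in> Ob Sh"
  shows "guarded_model (slice Sh I)
           (slice_later Sh (later K) (next_sh K) I)
           (slice_next Sh (later K) (next_sh K) I)"
proof -
  obtain d :: "('a \<Rightarrow> 'u) \<Rightarrow> 'u" where "inj d" using assms(2) by blast
  then interpret wf_basis_slice K d I
    by unfold_locales (use assms in simp_all)
  show ?thesis by (rule guarded_model_slice)
qed

end
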